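(* Suppose that, for some $r\in[1,\infty)$, $F\in L^2_{\mathbb{X}}\cap L^r_{\mathbb{X}}$. Moreover, let $d\in\mathbb{N}$ and let $k_1,\dotsc,k_d\in\mathbb{N}$ be pairwise distinct. Then $D^d_{k_1,\dotsc,k_d}L^{-1}(F-\mathbb{E}[F])\in L^r_{\mathbb{X}}$ and $$\bigl\|D^d_{k_1,\dotsc,k_d}L^{-1}(F-\mathbb{E}[F])\bigr\|_r\leq d^{-1}\bigl\|D^d_{k_1,\dotsc,k_d}F\bigr\|_r.$$
   Context: $\mathbb{N}=\{1,2,\ldots\}$. Let $(E_n,\mathcal{B}_n,\mu_n)$, $n\in\mathbb{N}$, be arbitrary probability spaces, and let $\mathbb{X}=(X_n)_{n\in\mathbb{N}}$ be a sequence of independent random variables on a probability space $(\Omega,\mathcal{A},\mathbb{P})$, where $X_n$ takes values in $E_n$ and has distribution $\mu_n$. Let $\mathcal{F}=\sigma(\mathbb{X})$ and $L^r_{\mathbb{X}}=L^r(\Omega,\mathcal{F},\mathbb{P})$ (real-valued), $\|F\|_r=(\mathbb{E}|F|^r)^{1/r}$. For $M\subseteq\mathbb{N}$ let $\mathcal{F}_M=\sigma(X_j,j\in M)$ and let $\mathcal{G}_k=\sigma(X_j,j\neq k)$. Infinite Hoeffding decomposition: for $F\in L^2_{\mathbb{X}}$ and finite $M\subseteq\mathbb{N}$ put $F_M:=\sum_{L\subseteq M}(-1)^{|M|-|L|}\mathbb{E}[F\,|\,\mathcal{F}_L]$. Then $F=\sum_{|M|<\infty}F_M$, with unconditional convergence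 in $L^2(\mathbb{P})$ and pairwise orthogonal summands. For $F\in L^1_{\mathbb{X}}$, $D_kF:=F-\mathbb{E}[F\,|\,\mathcal{G}_k]$, and for pairwise distinct $k_1,\dotsc,k_d$ the iterated Malliavin derivative is $D^d_{k_1,\dotsc,k_d}:=D_{k_1}\circ D_{k_2}\circ\cdots\circ D_{k_d}$ (the order is immaterial). The Ornstein-Uhlenbeck generator is $LF=-\sum_{|M|<\infty}|M|F_M$ on the domain of all $F\in L^2_{\mathbb{X}}$ with $\sum_{|M|<\infty}|M|^2\mathbb{E}[F_M^2]<\infty$. Its pseudo-inverse is defined for centered $G\in L^2_{\mathbb{X}}$ by $L^{-1}G:=-\sum_{\emptyset\neq M\subseteq\mathbb{N},\,|M|<\infty}\frac{1}{|M|}G_M$ (convergence in $L^2(\mathbb{P})$). *)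

theory Defs
  imports "HOL-Probability.Probability"
begin

text \<open>
  Random elements of the spaces \<open>E n\<close> are indexed by all of \<open>nat\<close>, i.e. the index set
  \<open>{1, 2, \<dots>}\<close> is relabelled by \<open>n \<mapsto> n - 1\<close>. Elements of \<open>L\<^sup>r\<close> are represented by functions;
  operators defined only up to almost sure equality return one fixed version.
\<close>

text \<open>
  Written as a generated sigma-algebra rather than a supremum of \<open>vimage_algebra\<close>s, so that
  \<open>J = {}\<close> gives the trivial sigma-algebra on \<open>space P\<close> (the empty supremum has empty space).
\<close>
definition sigma_of ::
  "'a measure \<Rightarrow> (nat \<Rightarrow> 'b measure) \<Rightarrow> (nat \<Rightarrow> 'a \<Rightarrow> 'b) \<Rightarrow> nat set \<Rightarrow> 'a measure" where
  "sigma_of P E X J = sigma (space P) (\<Union>j\<in>J. {X j -` A \<inter> space P | A. A \<in> sets (E j)})"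

definition Lr_space ::
  "'a measure \<Rightarrow> (nat \<Rightarrow> 'b measure) \<Rightarrow> (nat \<Rightarrow> 'a \<Rightarrow> 'b) \<Rightarrow> real \<Rightarrow> ('a \<Rightarrow> real) set" where
  "Lr_space P E X r =
     {F. F \<in> borel_measurable (sigma_of P E X UNIV) \<and> integrable P (\<lambda>\<omega>. \<bar>F \<omega>\<bar> powr r)}"

text \<open>Only meaningful if the integral is finite (the Bochner integral is \<open>0\<close> otherwise).\<close>
definition Lr_norm :: "'a measure \<Rightarrow> real \<Rightarrow> ('a \<Rightarrow> real) \<Rightarrow> real" where
  "Lr_norm P r F = (\<integral>\<omega>. \<bar>F \<omega>\<bar> powr r \<partial>P) powr (1 / r)"

definition hoeffding_component ::
  "'a measure \<Rightarrow> (nat \<Rightarrow> 'b measure) \<Rightarrow> (nat \<Rightarrow> 'a \<Rightarrow> 'b) \<Rightarrow> ('a \<Rightarrow> real) \<Rightarrow> nat set \<Rightarrow> 'a \<Rightarrow> real"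
  where
  "hoeffding_component P E X F M \<omega> =
     (\<Sum>L\<in>Pow M. (-1) ^ (card M - card L) * real_cond_exp P (sigma_of P E X L) F \<omega>)"

text \<open>Unconditional convergence in \<open>L\<^sup>2\<close>: the net of finite partial sums converges.\<close>
definition has_L2_sum ::
  "'a measure \<Rightarrow> (nat \<Rightarrow> 'b measure) \<Rightarrow> (nat \<Rightarrow> 'a \<Rightarrow> 'b) \<Rightarrow>
   ('i \<Rightarrow> 'a \<Rightarrow> real) \<Rightarrow> 'i set \<Rightarrow> ('a \<Rightarrow> real) \<Rightarrow> bool" where
  "has_L2_sum P E X f I H \<longleftrightarrow>
     (\<forall>i\<in>I. f i \<in> Lr_space P E X 2) \<and> H \<in> Lr_space P E X 2 \<and>
     ((\<lambda>S. Lr_norm P 2 (\<lambda>\<omega>. (\<Sum>i\<in>S. f i \<omega>) - H \<omega>)) \<longlongrightarrow> 0) (finite_subsets_at_top I)"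

text \<open>
  For centered square-integrable \<open>G\<close>. The \<open>L\<^sup>2\<close>-limit is unique up to almost sure equality;
  \<open>SOME\<close> picks a version of it.
\<close>
definition OU_pseudo_inverse ::
  "'a measure \<Rightarrow> (nat \<Rightarrow> 'b measure) \<Rightarrow> (nat \<Rightarrow> 'a \<Rightarrow> 'b) \<Rightarrow> ('a \<Rightarrow> real) \<Rightarrow> 'a \<Rightarrow> real" where
  "OU_pseudo_inverse P E X G =
     (SOME H. has_L2_sum P E X
        (\<lambda>M \<omega>. - (1 / real (card M)) * hoeffding_component P E X G M \<omega>)
        {M. finite M \<and> M \<noteq> {}} H)"

definition malliavin_D ::
  "'a measure \<Rightarrow> (nat \<Rightarrow> 'b measure) \<Rightarrow> (nat \<Rightarrow> 'a \<Rightarrow> 'b) \<Rightarrow> nat \<Rightarrow> ('a \<Rightarrow> real) \<Rightarrow> 'a \<Rightarrow> real" where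
  "malliavin_D P E X k F \<omega> = F \<omega> - real_cond_exp P (sigma_of P E X (- {k})) F \<omega>"

definition iterated_D ::
  "'a measure \<Rightarrow> (nat \<Rightarrow> 'b measure) \<Rightarrow> (nat \<Rightarrow> 'a \<Rightarrow> 'b) \<Rightarrow> nat list \<Rightarrow> ('a \<Rightarrow> real) \<Rightarrow> 'a \<Rightarrow> real"
  where
  "iterated_D P E X ks F = foldr (malliavin_D P E X) ks F"

end

theory Submission
  imports Defs
begin

text \<open>
  Let \<open>K\<close> be the set of the \<open>d\<close> indices and \<open>E\<^sub>J\<close> the conditional expectation given the coordinates
  in \<open>J\<close>. Independence enters only through \<open>E\<^sub>A E\<^sub>B = E\<^bsub>A \<inter> B\<^esub>\<close>. On finitely many further coordinates \<open>N\<close>,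
  comparison of Hoeffding components turns \<open>1 / (d + |J|)\<close>, the integral of \<open>s ^ (d + |J| - 1)\<close> over
  the unit interval, into
  \<open>E\<^bsub>K \<union> N\<^esub> D L\<^sup>-\<^sup>1 F = - (\<Sum>L \<subseteq> N. c\<^sub>L E\<^bsub>K \<union> L\<^esub> D F)\<close>, where \<open>c\<^sub>L \<ge> 0\<close> is a Beta integral and
  \<open>\<Sum>L \<subseteq> N. c\<^sub>L = 1 / d\<close>. This avoids the Ornstein-Uhlenbeck semigroup: Jensen's inequality gives the
  bound for the left-hand side, and Fatou's lemma along an almost surely convergent subsequence passes
  to the limit of growing \<open>N\<close>.
\<close>

subsection \<open>Sums over subsets\<close>

text \<open>The obstacle is that the pseudo-inverse multiplies Hoeffding components by constants
  that depend on the cardinality, and such a multiplier has no evident bound outside r = 2. It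
  becomes a contraction once it is written as an average of projections. Keep each coordinate of N
  independently with probability s: the mean of the projections onto the kept coordinates multiplies
  the component of J by \<open>s ^ card J\<close>, because the probability that all of J is kept is
  \<open>s ^ card J\<close>. Integrating this against \<open>s ^ (d - 1)\<close> yields the required
  factor. The shift by d comes from the differences. They annihilate every component whose index set
  does not contain K, so the surviving sets are K \<union> J with d + |J| elements. For the same
  reason K is kept in every projection: conditioning D F on coordinates that miss an index of K
  gives 0. Finite N intervene because the series of the pseudo-inverse converges in
  \<open>L\<^sup>2\<close>, which by itself controls no norm with r > 2.\<close>

definition moebius_sum :: "(nat set \<Rightarrow> real) \<Rightarrow> nat set \<Rightarrow> real" where
  "moebius_sum e M = (\<Sum>L\<in>Pow M. (-1) ^ (card M - card L) * e L)"

lemma sum_Pow_insert: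
  fixes f :: "'i set \<Rightarrow> 'c::comm_monoid_add"
  assumes "finite A" "a \<notin> A"
  shows "(\<Sum>M\<in>Pow (insert a A). f M) = (\<Sum>M\<in>Pow A. f M) + (\<Sum>M\<in>Pow A. f (insert a M))"
proof -
  have "inj_on (insert a) (Pow A)"
    using assms(2) by (intro inj_onI) (metis Diff_insert_absorb PowD insertCI insert_absorb insert_ident subsetD)
  then show ?thesis
    using assms by (subst Pow_insert, subst sum.union_disjoint) (auto simp: sum.reindex)
qed

text \<open>Subsets of \<open>insert a M\<close> pair off as L and \<open>insert a L\<close>; the
  sign of L flips because only the outer cardinality grew. A Moebius sum is thus an iterated
  difference of \<open>e\<close>, one difference per element of M.\<close>

lemma moebius_sum_insert:
  assumes "finite M" "a \<notin> M"
  shows "moebius_sum e (insert a M) = moebius_sum (\<lambda>L. e (insert a L)) M - moebius_sum e M"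
proof -
  have "(-1::real) ^ (card (insert a M) - card L) = - ((-1) ^ (card M - card L))"
    if "L \<in> Pow M" for L
    using that assms card_mono[of M L] by (simp add: Suc_diff_le)
  moreover have "(-1::real) ^ (card (insert a M) - card (insert a L)) = (-1) ^ (card M - card L)"
    if "L \<in> Pow M" for L
  proof -
    have "a \<notin> L" "finite L" using that assms by (auto intro: finite_subset)
    then show ?thesis using assms by simp
  qed
  ultimately show ?thesis
    unfolding moebius_sum_def using assms
    by (simp add: sum_Pow_insert sum_negf)
qed

text \<open>Moebius inversion on the subset lattice. The sums for M and \<open>insert a M\<close>
  telescope to the sum for the shifted function \<open>L \<mapsto> e (insert a L)\<close>, which is
  why \<open>e\<close> stays arbitrary in the induction.\<close>

lemma sum_moebius_sum:
  assumes "finite A"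
  shows "(\<Sum>M\<in>Pow A. moebius_sum e M) = e A"
  using assms
proof (induction A arbitrary: e rule: finite_induct)
  case empty
  then show ?case by (simp add: moebius_sum_def)
next
  case (insert a A)
  have "(\<Sum>M\<in>Pow A. moebius_sum e (insert a M))
        = (\<Sum>M\<in>Pow A. moebius_sum (\<lambda>L. e (insert a L)) M - moebius_sum e M)"
    using insert.hyps by (intro sum.cong moebius_sum_insert) (auto intro: finite_subset)
  then show ?case
    using insert by (simp add: sum_Pow_insert sum_subtractf)
qed

text \<open>The difference in direction k of a function that ignores k is 0. This is how conditional
  expectations annihilate Hoeffding components.\<close>

lemma moebius_sum_eq_0:
  assumes "finite M" "k \<in> M" "\<And>L. e (insert k L) = e L"
  shows "moebius_sum e M = 0"
  using moebius_sum_insert[of "M - {k}" k e] assms by (simp add: insert_absorb)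

text \<open>Under the Beta integral this is (s + (1 - s))^|N| = 1, expanded over subsets. The
  induction uses a Pascal-type rule instead: a new element raises the first argument for the sets
  that contain it and the second for the others.\<close>

lemma sum_Beta_Pow:
  fixes x y :: real
  assumes "finite N" "x > 0" "y > 0"
  shows "(\<Sum>L\<in>Pow N. Beta (x + card L) (y + (card N - card L))) = Beta x y"
  using assms
proof (induction N arbitrary: x y rule: finite_induct)
  case empty
  then show ?case by simp
next
  case (insert a N)
  have fin: "finite L" "a \<notin> L" "card L \<le> card N" if "L \<in> Pow N" for L
    using that insert.hyps by (auto intro: finite_subset card_mono)
  have "(\<Sum>L\<in>Pow N. Beta (x + card L) (y + (card (insert a N) - card L)))
      = (\<Sum>L\<in>Pow N. Beta (x + card L) ((y + 1) + (card N - card L)))"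
    using insert.hyps fin by (intro sum.cong) (auto simp: Suc_diff_le add_ac)
  also have "\<dots> = Beta x (y + 1)"
    using insert by simp
  finally have 1: "(\<Sum>L\<in>Pow N. Beta (x + card L) (y + (card (insert a N) - card L))) = Beta x (y + 1)" .
  have "(\<Sum>L\<in>Pow N. Beta (x + card (insert a L)) (y + (card (insert a N) - card (insert a L))))
      = (\<Sum>L\<in>Pow N. Beta ((x + 1) + card L) (y + (card N - card L)))"
    using insert.hyps fin by (intro sum.cong) (auto simp: add_ac)
  also have "\<dots> = Beta (x + 1) y"
    using insert by simp
  finally have 2: "(\<Sum>L\<in>Pow N. Beta (x + card (insert a L)) (y + (card (insert a N) - card (insert a L)))) = Beta (x + 1) y" .
  have "x \<notin> \<int>\<^sub>\<le>\<^sub>0" "y \<notin> \<int>\<^sub>\<le>\<^sub>0"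
    using insert.prems by (auto elim!: nonpos_Ints_cases)
  then have "Beta (x + 1) y + Beta x (y + 1) = Beta x y"
    by (rule Beta_plus1_plus1)
  with 1 2 show ?case
    using insert.hyps by (simp add: sum_Pow_insert)
qed

lemma Beta_1_right:
  fixes x :: real
  assumes "x > 0"
  shows "Beta x 1 = 1 / x"
proof -
  have "x \<notin> \<int>\<^sub>\<le>\<^sub>0"
    using assms by (auto elim!: nonpos_Ints_cases)
  then show ?thesis
    using assms Gamma_plus1[of x] by (simp add: Beta_def Gamma_eq_zero_iff)
qed

text \<open>
  The weight of \<open>L\<close> is \<open>\<integral> s ^ (d - 1 + card L) * (1 - s) ^ card (N - L) ds\<close> over the unit interval.
\<close>
lemma averaging_weights:
  fixes d :: nat
  assumes "finite N" "1 \<le> d"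
  obtains c :: "'i set \<Rightarrow> real" where "\<And>L. 0 \<le> c L"
    "\<And>J. J \<subseteq> N \<Longrightarrow> (\<Sum>L\<in>{L. J \<subseteq> L \<and> L \<subseteq> N}. c L) = 1 / (d + card J)"
proof
  let ?c = "\<lambda>L. Beta (real d + card L) (1 + (card N - card L))"
  show "0 \<le> ?c L" for L
    using assms by (auto simp: Beta_def intro!: divide_nonneg_nonneg mult_nonneg_nonneg less_imp_le[OF Gamma_real_pos])
  show "(\<Sum>L\<in>{L. J \<subseteq> L \<and> L \<subseteq> N}. ?c L) = 1 / (d + card J)" if J: "J \<subseteq> N" for J
  proof -
    have finJ: "finite J" using J assms finite_subset by blast
    \<comment> \<open>Splitting J off every superset moves \<open>card J\<close> into the first Beta
      argument, so the sum over subsets of \<open>N - J\<close> collapses.\<close>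
    have "(\<Sum>L\<in>{L. J \<subseteq> L \<and> L \<subseteq> N}. ?c L) = (\<Sum>L\<in>Pow (N - J). ?c (J \<union> L))"
      by (rule sum.reindex_bij_witness[where i = "\<lambda>L. J \<union> L" and j = "\<lambda>L. L - J"])
        (use J in \<open>auto simp: Un_absorb1\<close>)
    also have "\<dots> = (\<Sum>L\<in>Pow (N - J). Beta ((real d + card J) + card L) (1 + (card (N - J) - card L)))"
    proof (intro sum.cong refl)
      fix L assume "L \<in> Pow (N - J)"
      then have "card (J \<union> L) = card J + card L" "finite L"
        using finJ assms by (auto intro!: card_Un_disjoint finite_subset[of L])
      then show "?c (J \<union> L) = Beta ((real d + card J) + card L) (1 + (card (N - J) - card L))"
        using J assms finJ by (simp add: card_Diff_subset add_ac)
    qed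
    also have "\<dots> = Beta (real d + card J) 1"
      using sum_Beta_Pow[of "N - J" "real d + card J" 1] assms by simp
    also have "\<dots> = 1 / (d + card J)"
      using assms by (subst Beta_1_right) auto
    finally show ?thesis .
  qed
qed

section \<open>Convexity of absolute powers\<close>

lemma convex_on_abs_powr:
  fixes r :: real
  assumes "1 \<le> r"
  shows "convex_on UNIV (\<lambda>x. \<bar>x\<bar> powr r)"
proof (rule convex_onI)
  fix t x y :: real
  assume t: "0 < t" "t < 1"
  \<comment> \<open>For a zero argument, where the convex combination is a single scaled power;
    \<open>powr_convex\<close> serves the strictly positive arguments.\<close>
  have scale: "(s * u) powr r \<le> s * u powr r" if "0 < s" "s < 1" "0 \<le> u" for s u :: real
    using that assms powr_mono'[of 1 r s] by (simp add: powr_mult mult_right_mono)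
  have pos: "((1 - t) * u + t * v) powr r \<le> (1 - t) * u powr r + t * v powr r"
    if "0 \<le> u" "0 \<le> v" for u v :: real
  proof (cases "u = 0 \<or> v = 0")
    case True
    then show ?thesis using scale[of t v] scale[of "1 - t" u] that t by auto
  next
    case False
    then show ?thesis
      using convex_onD[OF powr_convex[OF assms], of t u v] that t by auto
  qed
  have "\<bar>(1 - t) *\<^sub>R x + t *\<^sub>R y\<bar> \<le> (1 - t) * \<bar>x\<bar> + t * \<bar>y\<bar>"
    using t abs_triangle_ineq[of "(1 - t) * x" "t * y"] by (simp add: abs_mult)
  then have "\<bar>(1 - t) *\<^sub>R x + t *\<^sub>R y\<bar> powr r \<le> ((1 - t) * \<bar>x\<bar> + t * \<bar>y\<bar>) powr r"
    using assms by (intro powr_mono2) auto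
  also have "\<dots> \<le> (1 - t) * \<bar>x\<bar> powr r + t * \<bar>y\<bar> powr r"
    by (rule pos) auto
  finally show "\<bar>(1 - t) *\<^sub>R x + t *\<^sub>R y\<bar> powr r \<le> (1 - t) * \<bar>x\<bar> powr r + t * \<bar>y\<bar> powr r" .
qed auto

subsection \<open>Conditional expectations given independent coordinates\<close>

locale indep_family = prob_space P for P :: "'a measure" +
  fixes E :: "nat \<Rightarrow> 'b measure" and X :: "nat \<Rightarrow> 'a \<Rightarrow> 'b"
  assumes indep: "indep_vars E X UNIV"
begin

abbreviation "\<S> \<equiv> sigma_of P E X"

abbreviation "ce J \<equiv> real_cond_exp P (\<S> J)"

abbreviation "D \<equiv> iterated_D P E X"

lemma X_measurable [measurable]: "X n \<in> measurable P (E n)"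
  using indep by (auto simp: indep_vars_def2)

lemma sets_sigma_of:
  "sets (\<S> J) = sigma_sets (space P) (\<Union>j\<in>J. {X j -` A \<inter> space P | A. A \<in> sets (E j)})"
  unfolding sigma_of_def by (rule sets_measure_of) auto

lemma space_sigma_of [simp]: "space (\<S> J) = space P"
  unfolding sigma_of_def by (rule space_measure_of) auto

lemma subalgebra_sigma_of: "subalgebra P (\<S> J)"
  unfolding subalgebra_def sets_sigma_of
  by (auto intro!: sets.sigma_sets_subset)

lemma sigma_of_mono:
  assumes "I \<subseteq> J"
  shows "subalgebra (\<S> J) (\<S> I)"
  using assms unfolding subalgebra_def by (auto simp: sets_sigma_of intro!: sigma_sets_mono')

sublocale ce: finite_measure_subalgebra P "\<S> J" for J
  by unfold_locales (rule subalgebra_sigma_of)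

lemma sets_sigma_of_subset: "a \<in> sets (\<S> J) \<Longrightarrow> a \<in> sets P"
  using subalgebra_sigma_of unfolding subalgebra_def by auto

lemma sets_sigma_of_mono: "a \<in> sets (\<S> I) \<Longrightarrow> I \<subseteq> J \<Longrightarrow> a \<in> sets (\<S> J)"
  using sigma_of_mono unfolding subalgebra_def by auto

lemma measurable_sigma_of: "f \<in> borel_measurable (\<S> J) \<Longrightarrow> f \<in> borel_measurable P"
  using measurable_from_subalg[OF subalgebra_sigma_of] .

lemma measurable_sigma_of_mono:
  "f \<in> borel_measurable (\<S> I) \<Longrightarrow> I \<subseteq> J \<Longrightarrow> f \<in> borel_measurable (\<S> J)"
  using measurable_from_subalg[OF sigma_of_mono] .

lemma integrable_indicator_event: "a \<in> events \<Longrightarrow> integrable P (indicator a :: _ \<Rightarrow> real)"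
  by (rule integrable_real_indicator) (auto simp: less_top[symmetric])

text \<open>Independence of single coordinates extends to disjoint blocks because the preimage
  events of one coordinate are closed under intersection. The two blocks form a family over the
  Booleans, the shape to which \<open>indep_set\<close> unfolds.\<close>

lemma prob_Int_sigma_of:
  assumes "A \<inter> B = {}" "a \<in> sets (\<S> A)" "b \<in> sets (\<S> B)"
  shows "prob (a \<inter> b) = prob a * prob b"
proof -
  let ?G = "\<lambda>j. {X j -` A \<inter> space P | A. A \<in> sets (E j)}"
  have "indep_sets ?G (\<Union>j\<in>UNIV. case_bool A B j)"
    using indep indep_sets_mono_index[of _ UNIV ?G] by (auto simp: indep_vars_def2)
  then have "indep_sets (\<lambda>j. sigma_sets (space P) (\<Union>i\<in>case_bool A B j. ?G i)) UNIV"
  proof (rule indep_sets_collect_sigma)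
    show "Int_stable (?G i)" for i
    proof (rule Int_stableI)
      fix a b assume "a \<in> ?G i" "b \<in> ?G i"
      then obtain A B where "a = X i -` A \<inter> space P" "b = X i -` B \<inter> space P"
        "A \<in> sets (E i)" "B \<in> sets (E i)" by auto
      then show "a \<inter> b \<in> ?G i" by (intro CollectI exI[of _ "A \<inter> B"]) auto
    qed
    show "disjoint_family_on (case_bool A B) UNIV"
      using assms(1) by (auto simp: disjoint_family_on_def split: bool.splits)
  qed
  also have "(\<lambda>j. sigma_sets (space P) (\<Union>i\<in>case_bool A B j. ?G i))
      = case_bool (sets (\<S> A)) (sets (\<S> B))"
    by (auto simp: sets_sigma_of fun_eq_iff split: bool.splits)
  finally have "indep_set (sets (\<S> A)) (sets (\<S> B))"
    unfolding indep_set_def .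
  then show ?thesis using assms by (auto dest: indep_setD)
qed

lemma cond_exp_indep:
  assumes "C \<inter> B = {}" "b \<in> sets (\<S> B)"
  shows "AE x in P. ce C (indicator b) x = prob b"
proof (rule ce.real_cond_exp_charact)
  note [measurable] = sets_sigma_of_subset[OF assms(2)]
  fix a assume a: "a \<in> sets (\<S> C)"
  note [measurable] = sets_sigma_of_subset[OF a]
  show "(\<integral>x\<in>a. indicator b x \<partial>P) = (\<integral>x\<in>a. prob b \<partial>P)"
    using prob_Int_sigma_of[OF assms(1) a assms(2)]
    by (simp add: set_lebesgue_integral_def indicator_inter_arith[symmetric])
qed (use sets_sigma_of_subset[OF assms(2)] in \<open>auto intro: integrable_indicator_event\<close>)

text \<open>Provides the rectangles for the Dynkin argument of the next lemma. A preimage event of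
  one coordinate is a rectangle whose other side is the whole space.\<close>

lemma sigma_of_generator:
  assumes "A = I \<union> J"
  shows "sets (\<S> A) = sigma_sets (space P) {c \<inter> d | c d. c \<in> sets (\<S> I) \<and> d \<in> sets (\<S> J)}"
    (is "_ = sigma_sets _ ?G")
proof
  have "X j -` Y \<inter> space P \<in> ?G" if "j \<in> A" "Y \<in> sets (E j)" for j Y
  proof -
    have gen: "X j -` Y \<inter> space P \<in> sets (\<S> L)" if "j \<in> L" for L
      using that \<open>Y \<in> sets (E j)\<close> by (auto simp: sets_sigma_of)
    have top: "space P \<in> sets (\<S> L)" for L
      using sets.top[of "\<S> L"] by simp
    show ?thesis
    proof (cases "j \<in> I")
      case True
      then show ?thesis using gen top by (intro CollectI exI[of _ "X j -` Y \<inter> space P"] exI[of _ "space P"]) auto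
    next
      case False
      then show ?thesis using gen top \<open>j \<in> A\<close> assms
        by (intro CollectI exI[of _ "X j -` Y \<inter> space P"] exI[of _ "space P"]) auto
    qed
  qed
  then show "sets (\<S> A) \<subseteq> sigma_sets (space P) ?G"
    unfolding sets_sigma_of[of A] by (intro sigma_sets_mono') auto
  have "?G \<subseteq> sets (\<S> A)"
    using sets_sigma_of_mono[of _ I A] sets_sigma_of_mono[of _ J A] assms by auto
  then show "sigma_sets (space P) ?G \<subseteq> sets (\<S> A)"
    using sets.sigma_sets_subset[of ?G "\<S> A"] by simp
qed

text \<open>It is enough to compare integrals over rectangles c \<inter> d with c in
  \<open>\<S> (A \<inter> B)\<close> and d in \<open>\<S> (A - B)\<close>: c is known to the
  candidate \<open>?g\<close>, and d is independent of everything that depends on B. Complements and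
  disjoint unions follow by additivity of the set integral.\<close>

lemma cond_exp_indicator_Int:
  assumes b: "b \<in> sets (\<S> B)"
  shows "AE x in P. ce A (indicator b) x = ce (A \<inter> B) (indicator b) x"
proof (rule ce.real_cond_exp_charact)
  note [measurable] = sets_sigma_of_subset[OF b]
  let ?g = "ce (A \<inter> B) (indicator b)"
  let ?G = "{c \<inter> d | c d. c \<in> sets (\<S> (A \<inter> B)) \<and> d \<in> sets (\<S> (A - B))}"
  show ib: "integrable P (indicator b :: _ \<Rightarrow> real)"
    by (rule integrable_indicator_event) measurable
  then show ig: "integrable P ?g" by (rule ce.real_cond_exp_int(1))
  show "?g \<in> borel_measurable (\<S> A)"
    by (rule measurable_sigma_of_mono[of _ "A \<inter> B"]) auto
  have set_int: "set_integrable P a f" if "a \<in> sets P" "integrable P f" for a and f :: "'a \<Rightarrow> real"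
    using that unfolding set_integrable_def by (intro integrable_mult_indicator)
  have gen: "sets (\<S> A) = sigma_sets (space P) ?G"
    by (rule sigma_of_generator) auto
  have stable: "Int_stable ?G"
  proof (rule Int_stableI)
    fix a b assume "a \<in> ?G" "b \<in> ?G"
    then obtain c d c' d' where "a = c \<inter> d" "b = c' \<inter> d'" "c \<in> sets (\<S> (A \<inter> B))" "c' \<in> sets (\<S> (A \<inter> B))"
       "d \<in> sets (\<S> (A - B))" "d' \<in> sets (\<S> (A - B))" by auto
    then show "a \<inter> b \<in> ?G" by (intro CollectI exI[of _ "c \<inter> c'"] exI[of _ "d \<inter> d'"]) auto
  qed
  have G_Pow: "?G \<subseteq> Pow (space P)"
    using sets.sets_into_space[of _ "\<S> (A \<inter> B)"] by auto
  fix a assume "a \<in> sets (\<S> A)"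
  then have "a \<in> sigma_sets (space P) ?G" by (simp add: gen)
  from stable G_Pow this show "(\<integral>x\<in>a. indicator b x \<partial>P) = (\<integral>x\<in>a. ?g x \<partial>P)"
  proof (induction rule: sigma_sets_induct_disjoint)
    case (basic a)
    then obtain c d where a: "a = c \<inter> d" and c: "c \<in> sets (\<S> (A \<inter> B))" and d: "d \<in> sets (\<S> (A - B))"
      by auto
    note [measurable] = sets_sigma_of_subset[OF c] sets_sigma_of_subset[OF d] c
    \<comment> \<open>Both c and b depend on coordinates in B only, which \<open>A - B\<close>
      avoids, so d splits off as a factor.\<close>
    have "c \<inter> b \<in> sets (\<S> B)"
      using b sets_sigma_of_mono[OF c, of B] by auto
    then have "prob (d \<inter> (c \<inter> b)) = prob d * prob (c \<inter> b)"
      using d by (intro prob_Int_sigma_of) auto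
    moreover have "prob (c \<inter> b) = (\<integral>x\<in>c. ?g x \<partial>P)"
      using ce.real_cond_exp_intA[OF ib c]
      by (simp add: set_lebesgue_integral_def indicator_inter_arith[symmetric])
    \<comment> \<open>The same factor on the side of the candidate: the rest of the integrand is
      measurable for \<open>A \<inter> B\<close>, so \<open>indicator d\<close> may be replaced by
      its conditional probability, a constant by independence.\<close>
    moreover have "(\<integral>x. (indicator c x * ?g x) * indicator d x \<partial>P) = prob d * (\<integral>x\<in>c. ?g x \<partial>P)"
    proof -
      have i: "integrable P (\<lambda>x. (indicator c x * ?g x) * indicator d x)"
        using integrable_mult_indicator[OF _ integrable_mult_indicator[OF _ ig], of d c]
        by (simp add: mult_ac)
      have "(\<integral>x. (indicator c x * ?g x) * indicator d x \<partial>P)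
          = (\<integral>x. (indicator c x * ?g x) * ce (A \<inter> B) (indicator d) x \<partial>P)"
        by (rule ce.real_cond_exp_intg(2)[OF i, symmetric]) auto
      also have "\<dots> = (\<integral>x. (indicator c x * ?g x) * prob d \<partial>P)"
      proof (rule integral_cong_AE)
        have "AE x in P. ce (A \<inter> B) (indicator d) x = prob d"
          by (rule cond_exp_indep[of _ "A - B"]) (use d in auto)
        then show "AE x in P. (indicator c x * ?g x) * ce (A \<inter> B) (indicator d) x
            = (indicator c x * ?g x) * prob d"
          by eventually_elim simp
      qed measurable
      finally show ?thesis
        by (simp only: integral_mult_left_zero set_lebesgue_integral_def real_scaleR_def mult.commute[of "prob d"])
    qed
    moreover have "(\<integral>x\<in>a. ?g x \<partial>P) = (\<integral>x. (indicator c x * ?g x) * indicator d x \<partial>P)"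
      unfolding set_lebesgue_integral_def a indicator_inter_arith by (simp add: mult_ac)
    moreover have "(\<integral>x\<in>a. (indicator b x :: real) \<partial>P) = prob (d \<inter> (c \<inter> b))"
    proof -
      have "(\<integral>x\<in>a. indicator b x \<partial>P) = (\<integral>x. (indicator (d \<inter> (c \<inter> b)) x :: real) \<partial>P)"
        unfolding set_lebesgue_integral_def a by (intro Bochner_Integration.integral_cong) (auto simp: indicator_def)
      then show ?thesis by simp
    qed
    ultimately show ?case by simp
  next
    case empty
    show ?case by (simp add: set_lebesgue_integral_def)
  next
    case (compl a)
    then have "a \<in> sets (\<S> A)" by (simp add: gen)
    note [measurable] = sets_sigma_of_subset[OF this]
    have split: "(\<integral>x\<in>space P - a. f x \<partial>P) = (\<integral>x. f x \<partial>P) - (\<integral>x\<in>a. f x \<partial>P)"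
      if "integrable P f" for f :: "'a \<Rightarrow> real"
    proof -
      have "(\<integral>x\<in>space P. f x \<partial>P) = (\<integral>x\<in>a \<union> (space P - a). f x \<partial>P)"
        by (intro arg_cong[where f = "\<lambda>s. set_lebesgue_integral P s f"]) (use sets.sets_into_space[of a P] in auto)
      also have "\<dots> = (\<integral>x\<in>a. f x \<partial>P) + (\<integral>x\<in>space P - a. f x \<partial>P)"
        by (rule set_integral_Un) (use that in \<open>auto intro!: set_int\<close>)
      finally show ?thesis using set_integral_space[OF that] by simp
    qed
    show ?case using compl ce.real_cond_exp_int(2)[OF ib] by (simp only: split[OF ib] split[OF ig])
  next
    case (union a)
    then have "a i \<in> sets (\<S> A)" for i by (auto simp: gen)
    then have m: "a i \<in> sets P" for i by (rule sets_sigma_of_subset)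
    then have m': "(\<Union>i. a i) \<in> sets P" by auto
    have split: "(\<integral>x\<in>(\<Union>i. a i). f x \<partial>P) = (\<Sum>i. (\<integral>x\<in>a i. f x \<partial>P))"
      if "integrable P f" for f :: "'a \<Rightarrow> real"
      by (rule lebesgue_integral_countable_add)
         (use m m' union that in \<open>auto intro!: set_int simp: disjoint_family_on_def\<close>)
    show ?case by (simp only: split[OF ib] split[OF ig] union)
  qed
qed

text \<open>Self-adjointness with an indicator on one side. The conditional expectation of the
  indicator lies in [0, 1], so its product with a merely integrable f is integrable; identities then
  pass from indicators to f by duality, with no approximation of f.\<close>

lemma cond_exp_indicator_adjoint:
  assumes [measurable]: "a \<in> sets P" and f: "integrable P f"
  shows "integrable P (\<lambda>x. ce J (indicator a) x * f x)"
    and "(\<integral>x. indicator a x * ce J f x \<partial>P) = (\<integral>x. ce J (indicator a) x * f x \<partial>P)"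
proof -
  have [measurable]: "f \<in> borel_measurable P" using f by auto
  have ia: "integrable P (indicator a :: _ \<Rightarrow> real)"
    by (rule integrable_indicator_event) measurable
  have bd: "AE x in P. 0 \<le> ce J (indicator a) x" "AE x in P. ce J (indicator a) x \<le> 1"
    by (auto intro!: ce.real_cond_exp_pos ce.real_cond_exp_le_c ia)
  show i: "integrable P (\<lambda>x. ce J (indicator a) x * f x)"
  proof (rule Bochner_Integration.integrable_bound[OF f])
    show "AE x in P. norm (ce J (indicator a) x * f x) \<le> norm (f x)"
      using bd by eventually_elim (auto simp: abs_mult intro!: mult_left_le_one_le)
  qed auto
  have i2: "integrable P (\<lambda>x. ce J f x * indicator a x)"
    using integrable_mult_indicator[OF assms(1) ce.real_cond_exp_int(1)[OF f, of J]] by (simp add: mult_ac)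
  have "(\<integral>x. ce J f x * indicator a x \<partial>P) = (\<integral>x. ce J f x * ce J (indicator a) x \<partial>P)"
    by (rule ce.real_cond_exp_intg(2)[OF i2, symmetric]) auto
  also have "\<dots> = (\<integral>x. ce J (indicator a) x * ce J f x \<partial>P)" by (simp add: mult_ac)
  also have "\<dots> = (\<integral>x. ce J (indicator a) x * f x \<partial>P)"
    by (rule ce.real_cond_exp_intg(2)[OF i]) auto
  finally show "(\<integral>x. indicator a x * ce J f x \<partial>P) = (\<integral>x. ce J (indicator a) x * f x \<partial>P)"
    by (simp add: mult_ac)
qed

text \<open>Tested against an event a of \<open>\<S> A\<close>, \<open>ce B\<close> moves onto the
  indicator, becomes \<open>ce (A \<inter> B)\<close> by the indicator case with A and B exchanged,
  and moves back.\<close>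

lemma cond_exp_cond_exp:
  assumes f: "integrable P f"
  shows "AE x in P. ce A (ce B f) x = ce (A \<inter> B) f x"
proof (rule ce.real_cond_exp_charact)
  show "integrable P (ce B f)" "integrable P (ce (A \<inter> B) f)"
    using f by (auto intro: ce.real_cond_exp_int)
  show "ce (A \<inter> B) f \<in> borel_measurable (\<S> A)"
    by (rule measurable_sigma_of_mono[of _ "A \<inter> B"]) auto
  fix a assume a: "a \<in> sets (\<S> A)"
  note [measurable] = sets_sigma_of_subset[OF a] borel_measurable_integrable[OF f]
  have "(\<integral>x. indicator a x * ce B f x \<partial>P) = (\<integral>x. ce B (indicator a) x * f x \<partial>P)"
    by (rule cond_exp_indicator_adjoint) (auto simp: f)
  also have "\<dots> = (\<integral>x. ce (A \<inter> B) (indicator a) x * f x \<partial>P)"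
    by (rule integral_cong_AE) (use cond_exp_indicator_Int[OF a, of B] in \<open>auto simp: Int_ac\<close>)
  also have "\<dots> = (\<integral>x. indicator a x * ce (A \<inter> B) f x \<partial>P)"
    by (rule cond_exp_indicator_adjoint(2)[symmetric]) (auto simp: f)
  finally show "(\<integral>x\<in>a. ce B f x \<partial>P) = (\<integral>x\<in>a. ce (A \<inter> B) f x \<partial>P)"
    by (simp add: set_lebesgue_integral_def)
qed

end

subsection \<open>Hoeffding components\<close>

lemma (in finite_measure) square_integrable_mult:
  fixes f g :: "'a \<Rightarrow> real"
  assumes [measurable]: "f \<in> borel_measurable M" "g \<in> borel_measurable M"
    and "integrable M (\<lambda>x. (f x)\<^sup>2)" "integrable M (\<lambda>x. (g x)\<^sup>2)"
  shows "integrable M (\<lambda>x. f x * g x)"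
proof (rule Bochner_Integration.integrable_bound)
  show "integrable M (\<lambda>x. (f x)\<^sup>2 + (g x)\<^sup>2)" using assms by simp
  have "\<bar>a * b\<bar> \<le> a\<^sup>2 + b\<^sup>2" for a b :: real
    using sum_squares_bound[of "\<bar>a\<bar>" "\<bar>b\<bar>"] mult_nonneg_nonneg[of "\<bar>a\<bar>" "\<bar>b\<bar>"]
    unfolding abs_mult mult.assoc power2_abs by linarith
  then show "AE x in M. norm (f x * g x) \<le> norm ((f x)\<^sup>2 + (g x)\<^sup>2)" by (auto simp: abs_of_nonneg)
qed auto

lemma (in finite_measure) square_integrable_add:
  fixes f g :: "'a \<Rightarrow> real"
  assumes "f \<in> borel_measurable M" "g \<in> borel_measurable M"
    and "integrable M (\<lambda>x. (f x)\<^sup>2)" "integrable M (\<lambda>x. (g x)\<^sup>2)"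
  shows "integrable M (\<lambda>x. (f x + g x)\<^sup>2)"
  using square_integrable_mult[OF assms] assms by (simp add: power2_sum mult.assoc)

lemma (in finite_measure) square_integrable_sum:
  fixes f :: "'i \<Rightarrow> 'a \<Rightarrow> real"
  assumes "\<And>i. i \<in> I \<Longrightarrow> f i \<in> borel_measurable M" "\<And>i. i \<in> I \<Longrightarrow> integrable M (\<lambda>x. (f i x)\<^sup>2)"
  shows "integrable M (\<lambda>x. (\<Sum>i\<in>I. f i x)\<^sup>2)"
  using assms
proof (induction I rule: infinite_finite_induct)
  case (insert i I)
  then show ?case using square_integrable_add[of "f i" "\<lambda>x. \<Sum>i\<in>I. f i x"] by simp
qed auto

text \<open>Nonnegativity of the variance of the absolute value. It turns \<open>L\<^sup>2\<close>
  convergence into \<open>L\<^sup>1\<close> convergence, the mode in which conditional expectations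
  and differences are estimated later.\<close>

lemma (in prob_space) abs_expectation_le_sqrt:
  fixes f :: "'a \<Rightarrow> real"
  assumes [measurable]: "f \<in> borel_measurable M" and sq: "integrable M (\<lambda>x. (f x)\<^sup>2)"
  shows "expectation (\<lambda>x. \<bar>f x\<bar>) \<le> sqrt (expectation (\<lambda>x. (f x)\<^sup>2))"
proof -
  have "integrable M (\<lambda>x. \<bar>f x\<bar>)"
    using square_integrable_imp_integrable[OF _ sq] by auto
  then have "(expectation (\<lambda>x. \<bar>f x\<bar>))\<^sup>2 \<le> expectation (\<lambda>x. (f x)\<^sup>2)"
    using variance_eq[of "\<lambda>x. \<bar>f x\<bar>"] variance_positive[of "\<lambda>x. \<bar>f x\<bar>"] sq by simp
  then show ?thesis by (rule real_le_rsqrt)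
qed

context indep_family
begin

abbreviation "hc \<equiv> hoeffding_component P E X"

lemma hc_moebius_sum: "hc F M \<omega> = moebius_sum (\<lambda>L. ce L F \<omega>) M"
  by (simp add: hoeffding_component_def moebius_sum_def)

lemma sum_hc: "finite A \<Longrightarrow> (\<Sum>M\<in>Pow A. hc F M \<omega>) = ce A F \<omega>"
  by (simp add: hc_moebius_sum sum_moebius_sum)

lemma hc_measurable_sigma_of: "hc F M \<in> borel_measurable (\<S> M)"
  unfolding hoeffding_component_def[abs_def]
  by (intro borel_measurable_sum borel_measurable_times borel_measurable_const)
     (auto intro: measurable_sigma_of_mono[OF borel_measurable_cond_exp])

lemma hc_measurable [measurable]: "hc F M \<in> borel_measurable P"
  using hc_measurable_sigma_of by (rule measurable_sigma_of)

lemma integrable_hc: "integrable P F \<Longrightarrow> integrable P (hc F M)"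
  unfolding hoeffding_component_def[abs_def]
  by (intro Bochner_Integration.integrable_sum integrable_mult_right ce.real_cond_exp_int)

lemma cond_exp_sum:
  assumes "\<And>i. i \<in> I \<Longrightarrow> integrable P (f i)"
  shows "AE x in P. ce A (\<lambda>x. \<Sum>i\<in>I. f i x) x = (\<Sum>i\<in>I. ce A (f i) x)"
proof -
  have "AE x in P. ce A (\<lambda>x. \<Sum>i\<in>I. (if i \<in> I then f i else (\<lambda>_. 0)) x) x
      = (\<Sum>i\<in>I. ce A (if i \<in> I then f i else (\<lambda>_. 0)) x)"
    by (rule ce.real_cond_exp_sum) (use assms in auto)
  then show ?thesis by simp
qed

text \<open>\<open>ce A\<close> produces the Moebius sum of
  \<open>L \<mapsto> ce (A \<inter> L) F x\<close>. If M lies in A this is the component itself;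
  otherwise some k in M outside A has no influence on \<open>A \<inter> L\<close>.\<close>

lemma cond_exp_hc:
  assumes F: "integrable P F" and M: "finite M"
  shows "AE x in P. ce A (hc F M) x = (if M \<subseteq> A then hc F M x else 0)"
proof -
  have int: "integrable P (\<lambda>x. c * ce L F x)" for c L
    using F by (auto intro: ce.real_cond_exp_int)
  have "AE x in P. ce A (hc F M) x = (\<Sum>L\<in>Pow M. ce A (\<lambda>x. (-1) ^ (card M - card L) * ce L F x) x)"
    unfolding hoeffding_component_def[abs_def] by (rule cond_exp_sum) (rule int)
  moreover have "AE x in P. \<forall>L\<in>Pow M. ce A (\<lambda>x. (-1) ^ (card M - card L) * ce L F x) x
      = (-1) ^ (card M - card L) * ce (A \<inter> L) F x"
  proof (rule AE_finite_allI)
    show "finite (Pow M)" using M by simp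
    fix L
    have "AE x in P. ce A (\<lambda>x. (-1) ^ (card M - card L) * ce L F x) x = (-1) ^ (card M - card L) * ce A (ce L F) x"
      using F by (intro ce.real_cond_exp_cmult ce.real_cond_exp_int)
    then show "AE x in P. ce A (\<lambda>x. (-1) ^ (card M - card L) * ce L F x) x = (-1) ^ (card M - card L) * ce (A \<inter> L) F x"
      using cond_exp_cond_exp[OF F, of A L] by eventually_elim simp
  qed
  ultimately have "AE x in P. ce A (hc F M) x = moebius_sum (\<lambda>L. ce (A \<inter> L) F x) M"
    by eventually_elim (simp add: moebius_sum_def)
  moreover have "moebius_sum (\<lambda>L. ce (A \<inter> L) F x) M = (if M \<subseteq> A then hc F M x else 0)" for x
  proof (cases "M \<subseteq> A")
    case True
    then have "A \<inter> L = L" if "L \<in> Pow M" for L using that by auto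
    then show ?thesis using True by (simp add: hoeffding_component_def moebius_sum_def)
  next
    case False
    then obtain k where k: "k \<in> M" "k \<notin> A" by auto
    then have "moebius_sum (\<lambda>L. ce (A \<inter> L) F x) M = 0"
      using M by (intro moebius_sum_eq_0[of _ k]) auto
    then show ?thesis using False by simp
  qed
  ultimately show ?thesis by simp
qed

text \<open>Conditional Jensen followed by integration. The function q is general so as to cover
  both the square, for Bessel's inequality, and the absolute r-th power, for the norm bound.\<close>

lemma cond_exp_convex_contraction:
  assumes F: "integrable P F" "integrable P (\<lambda>x. q (F x))"
    and q: "convex_on UNIV q" "q \<in> borel_measurable borel"
  shows "integrable P (\<lambda>x. q (ce J F x))" "(\<integral>x. q (ce J F x) \<partial>P) \<le> (\<integral>x. q (F x) \<partial>P)"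
proof -
  have j: "AE x in P. q (ce J F x) \<le> ce J (\<lambda>x. q (F x)) x"
    by (rule ce.real_cond_exp_jensens_inequality(2)[where I = UNIV]) (auto simp: F q)
  show i: "integrable P (\<lambda>x. q (ce J F x))"
    by (rule ce.integrable_convex_cond_exp[where I = UNIV]) (auto simp: F q)
  have "(\<integral>x. q (ce J F x) \<partial>P) \<le> (\<integral>x. ce J (\<lambda>x. q (F x)) x \<partial>P)"
    using i j ce.real_cond_exp_int(1)[OF F(2)] by (intro integral_mono_AE) auto
  then show "(\<integral>x. q (ce J F x) \<partial>P) \<le> (\<integral>x. q (F x) \<partial>P)"
    using ce.real_cond_exp_int(2)[OF F(2)] by simp
qed

lemma square_integrable_cond_exp:
  assumes "F \<in> borel_measurable P" "integrable P (\<lambda>x. (F x)\<^sup>2)"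
  shows "integrable P (\<lambda>x. (ce J F x)\<^sup>2)" "(\<integral>x. (ce J F x)\<^sup>2 \<partial>P) \<le> (\<integral>x. (F x)\<^sup>2 \<partial>P)"
  using cond_exp_convex_contraction[OF square_integrable_imp_integrable[OF assms] assms(2) convex_power2]
  by auto

lemma square_integrable_hc:
  assumes "F \<in> borel_measurable P" "integrable P (\<lambda>x. (F x)\<^sup>2)"
  shows "integrable P (\<lambda>x. (hc F M x)\<^sup>2)"
  unfolding hoeffding_component_def
  using square_integrable_cond_exp(1)[OF assms]
  by (intro square_integrable_sum) (auto simp: power_mult_distrib)

text \<open>Of two distinct sets one, say M, is not contained in the other. Conditioning on the
  coordinates of N leaves \<open>hc F N\<close> in place and sends \<open>hc F M\<close> to
  0.\<close>

lemma hc_orthogonal: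
  assumes F: "F \<in> borel_measurable P" "integrable P (\<lambda>x. (F x)\<^sup>2)" and "finite M" "finite N" "M \<noteq> N"
  shows "(\<integral>x. hc F M x * hc F N x \<partial>P) = 0"
proof -
  have iF: "integrable P F" using F by (rule square_integrable_imp_integrable)
  have main: "(\<integral>x. hc F N x * hc F M x \<partial>P) = 0" if "finite M" "\<not> M \<subseteq> N" for M N
  proof -
    have i: "integrable P (\<lambda>x. hc F N x * hc F M x)"
      using square_integrable_hc[OF F] by (intro square_integrable_mult) auto
    have "(\<integral>x. hc F N x * hc F M x \<partial>P) = (\<integral>x. hc F N x * ce N (hc F M) x \<partial>P)"
      by (rule ce.real_cond_exp_intg(2)[OF i, symmetric]) (auto intro: hc_measurable_sigma_of)
    also have "\<dots> = (\<integral>x. 0 \<partial>P)"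
      by (rule integral_cong_AE) (use cond_exp_hc[OF iF \<open>finite M\<close>, of N] that in auto)
    finally show ?thesis by simp
  qed
  show ?thesis
    using main[of M N] main[of N M] assms by (cases "M \<subseteq> N") (auto simp: mult.commute)
qed

lemma expectation_square_sum_orthogonal:
  fixes f :: "'i \<Rightarrow> 'a \<Rightarrow> real"
  assumes "finite S" and "\<And>i. i \<in> S \<Longrightarrow> f i \<in> borel_measurable P"
    and "\<And>i. i \<in> S \<Longrightarrow> integrable P (\<lambda>x. (f i x)\<^sup>2)"
    and "\<And>i j. i \<in> S \<Longrightarrow> j \<in> S \<Longrightarrow> i \<noteq> j \<Longrightarrow> (\<integral>x. f i x * f j x \<partial>P) = 0"
  shows "(\<integral>x. (\<Sum>i\<in>S. f i x)\<^sup>2 \<partial>P) = (\<Sum>i\<in>S. \<integral>x. (f i x)\<^sup>2 \<partial>P)"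
proof -
  have i: "integrable P (\<lambda>x. f i x * f j x)" if "i \<in> S" "j \<in> S" for i j
    using assms that by (intro square_integrable_mult) auto
  have "(\<integral>x. (\<Sum>i\<in>S. f i x)\<^sup>2 \<partial>P) = (\<Sum>i\<in>S. \<Sum>j\<in>S. \<integral>x. f i x * f j x \<partial>P)"
    using i by (simp add: power2_eq_square sum_product)
  also have "\<dots> = (\<Sum>i\<in>S. \<integral>x. (f i x)\<^sup>2 \<partial>P)"
  proof (rule sum.cong[OF refl])
    fix i assume "i \<in> S"
    then have "(\<Sum>j\<in>S. \<integral>x. f i x * f j x \<partial>P) = (\<Sum>j\<in>S. if i = j then \<integral>x. f i x * f i x \<partial>P else 0)"
      using assms by (intro sum.cong) auto
    then show "(\<Sum>j\<in>S. \<integral>x. f i x * f j x \<partial>P) = (\<integral>x. (f i x)\<^sup>2 \<partial>P)"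
      using assms \<open>i \<in> S\<close> by (simp add: power2_eq_square)
  qed
  finally show ?thesis .
qed

text \<open>Enlarging T to all subsets of its union turns the sum of components into a conditional
  expectation of F, which contracts the \<open>L\<^sup>2\<close> norm. The bound makes the series of
  the pseudo-inverse converge.\<close>

lemma hc_Bessel:
  assumes F: "F \<in> borel_measurable P" "integrable P (\<lambda>x. (F x)\<^sup>2)" and T: "finite T" "T \<subseteq> Collect finite"
  shows "(\<Sum>M\<in>T. \<integral>x. (hc F M x)\<^sup>2 \<partial>P) \<le> (\<integral>x. (F x)\<^sup>2 \<partial>P)"
proof -
  let ?A = "\<Union>T"
  have A: "finite ?A" using T by auto
  have "(\<Sum>M\<in>T. \<integral>x. (hc F M x)\<^sup>2 \<partial>P) \<le> (\<Sum>M\<in>Pow ?A. \<integral>x. (hc F M x)\<^sup>2 \<partial>P)"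
    using A by (intro sum_mono2) auto
  also have "\<dots> = (\<integral>x. (\<Sum>M\<in>Pow ?A. hc F M x)\<^sup>2 \<partial>P)"
    using A square_integrable_hc[OF F]
    by (intro expectation_square_sum_orthogonal[symmetric] hc_orthogonal[OF F]) (auto intro: finite_subset)
  also have "\<dots> = (\<integral>x. (ce ?A F x)\<^sup>2 \<partial>P)" using A by (simp add: sum_hc)
  also have "\<dots> \<le> (\<integral>x. (F x)\<^sup>2 \<partial>P)" by (rule square_integrable_cond_exp(2)[OF F])
  finally show ?thesis .
qed

end

subsection \<open>Orthogonal series and the pseudo-inverse\<close>

text \<open>Fatou's lemma for Bochner integrals, with integrability of the limit as a conclusion. It
  serves both the completeness of \<open>L\<^sup>2\<close> and the final limit of r-th
  powers.\<close>

lemma (in finite_measure) integral_le_of_AE_limit: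
  fixes f :: "nat \<Rightarrow> 'a \<Rightarrow> real"
  assumes int: "\<And>n. integrable M (f n)" and nonneg: "\<And>n x. 0 \<le> f n x"
    and bound: "\<And>n. integral\<^sup>L M (f n) \<le> C"
    and lim: "AE x in M. (\<lambda>n. f n x) \<longlonglongrightarrow> g x" and [measurable]: "g \<in> borel_measurable M"
  shows "integrable M g" "integral\<^sup>L M g \<le> C"
proof -
  have [measurable]: "f n \<in> borel_measurable M" for n using int[of n] by auto
  have C: "0 \<le> C"
    using order_trans[OF Bochner_Integration.integral_nonneg bound] nonneg by blast
  have g: "AE x in M. 0 \<le> g x"
    using lim by eventually_elim (auto intro!: LIMSEQ_le_const nonneg)
  have "(\<integral>\<^sup>+x. ennreal (g x) \<partial>M) = (\<integral>\<^sup>+x. liminf (\<lambda>n. ennreal (f n x)) \<partial>M)"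
  proof (rule nn_integral_cong_AE)
    show "AE x in M. ennreal (g x) = liminf (\<lambda>n. ennreal (f n x))"
      using lim by eventually_elim (simp add: lim_imp_Liminf[symmetric] tendsto_ennrealI)
  qed
  also have "\<dots> \<le> liminf (\<lambda>n. \<integral>\<^sup>+x. ennreal (f n x) \<partial>M)"
    by (rule nn_integral_liminf) simp
  also have "\<dots> \<le> liminf (\<lambda>n::nat. ennreal C)"
    by (intro Liminf_mono always_eventually)
       (auto simp: nn_integral_eq_integral int nonneg bound intro!: ennreal_leI)
  also have "\<dots> = ennreal C" by (simp add: Liminf_const)
  finally have le: "(\<integral>\<^sup>+x. ennreal (g x) \<partial>M) \<le> ennreal C" .
  then show i: "integrable M g"
    using g by (intro integrableI_nonneg) (auto simp: less_top[symmetric] top_unique)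
  show "integral\<^sup>L M g \<le> C"
    using le C g by (simp add: nn_integral_eq_integral[OF i g])
qed

text \<open>The rate \<open>(1/4) ^ n\<close> for squared distances bounds the
  \<open>L\<^sup>1\<close> norms of the increments by \<open>(1/2) ^ n\<close>. These are summable,
  so the sequence itself converges almost surely, and Fatou transfers the rate to the limit.\<close>

lemma (in prob_space) L2_Cauchy_limit:
  fixes u :: "nat \<Rightarrow> 'a \<Rightarrow> real"
  assumes sub: "subalgebra M G" and meas: "\<And>n. u n \<in> borel_measurable G"
    and sq: "\<And>n. integrable M (\<lambda>x. (u n x)\<^sup>2)"
    and cauchy: "\<And>m n. n \<le> m \<Longrightarrow> (\<integral>x. (u m x - u n x)\<^sup>2 \<partial>M) \<le> (1/4) ^ n"
  shows "\<exists>H\<in>borel_measurable G. integrable M (\<lambda>x. (H x)\<^sup>2) \<and>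
    (\<forall>n. integrable M (\<lambda>x. (u n x - H x)\<^sup>2) \<and> (\<integral>x. (u n x - H x)\<^sup>2 \<partial>M) \<le> (1/4) ^ n)"
proof -
  have [measurable]: "u n \<in> borel_measurable M" for n
    using measurable_from_subalg[OF sub meas] .
  have sqd: "integrable M (\<lambda>x. (u m x - u n x)\<^sup>2)" for m n
    using square_integrable_add[of "u m" "\<lambda>x. - u n x"] sq by simp
  \<comment> \<open>A pointwise limit on the whole space, unspecified where u diverges: this makes H
    measurable for G itself, not merely almost surely equal to such a function.\<close>
  define H where "H x = lim (\<lambda>n. u n x)" for x
  have H: "H \<in> borel_measurable G"
    unfolding H_def[abs_def] by (intro borel_measurable_lim_metric meas)
  have [measurable]: "H \<in> borel_measurable M" using measurable_from_subalg[OF sub H] .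
  have id: "integrable M (\<lambda>x. \<bar>u (Suc n) x - u n x\<bar>)" for n
    using square_integrable_imp_integrable[OF _ sqd] by auto
  have "(\<integral>x. \<bar>u (Suc n) x - u n x\<bar> \<partial>M) \<le> (1/2) ^ n" for n
  proof -
    have "(\<integral>x. \<bar>u (Suc n) x - u n x\<bar> \<partial>M) \<le> sqrt ((1/4) ^ n)"
      by (rule order_trans[OF abs_expectation_le_sqrt]) (use sqd cauchy in auto)
    also have "(1/4::real) ^ n = ((1/2) ^ n)\<^sup>2"
      by (simp add: power2_eq_square flip: power_mult_distrib)
    finally show ?thesis by simp
  qed
  then have "(\<integral>\<^sup>+x. ennreal \<bar>u (Suc n) x - u n x\<bar> \<partial>M) \<le> ennreal ((1/2) ^ n)" for n
    using id by (simp add: nn_integral_eq_integral ennreal_leI)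
  then have "(\<Sum>n. \<integral>\<^sup>+x. ennreal \<bar>u (Suc n) x - u n x\<bar> \<partial>M) \<le> (\<Sum>n. ennreal ((1/2) ^ n))"
    by (intro suminf_le) auto
  also have "\<dots> < top"
    by (subst suminf_ennreal2) (auto simp: less_top[symmetric] intro!: summable_geometric)
  finally have "(\<integral>\<^sup>+x. (\<Sum>n. ennreal \<bar>u (Suc n) x - u n x\<bar>) \<partial>M) \<noteq> \<infinity>"
    by (subst nn_integral_suminf) auto
  then have "AE x in M. (\<Sum>n. ennreal \<bar>u (Suc n) x - u n x\<bar>) \<noteq> \<infinity>"
    by (rule nn_integral_noteq_infinite[rotated]) simp
  then have lim: "AE x in M. (\<lambda>n. u n x) \<longlonglongrightarrow> H x"
  proof eventually_elim
    case (elim x)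
    then have "summable (\<lambda>n. \<bar>u (Suc n) x - u n x\<bar>)"
      by (intro summable_suminf_not_top) auto
    then have "summable (\<lambda>n. u (Suc n) x - u n x)" by (rule summable_rabs_cancel)
    then have "convergent (\<lambda>n. \<Sum>k<n. u (Suc k) x - u k x)"
      by (simp add: summable_iff_convergent)
    then have "convergent (\<lambda>n. u n x - u 0 x)" by (simp add: sum_lessThan_telescope[of "\<lambda>n. u n x"])
    then obtain l where "(\<lambda>n. u n x - u 0 x) \<longlonglongrightarrow> l" unfolding convergent_def ..
    then have "(\<lambda>n. (u n x - u 0 x) + u 0 x) \<longlonglongrightarrow> l + u 0 x" by (intro tendsto_add tendsto_const)
    then have "convergent (\<lambda>n. u n x)" unfolding convergent_def by auto
    then show ?case unfolding H_def by (simp add: convergent_LIMSEQ_iff)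
  qed
  have fatou: "integrable M (\<lambda>x. (u n x - H x)\<^sup>2)" "(\<integral>x. (u n x - H x)\<^sup>2 \<partial>M) \<le> (1/4) ^ n" for n
  proof -
    have l: "AE x in M. (\<lambda>m. (u (m + n) x - u n x)\<^sup>2) \<longlonglongrightarrow> (u n x - H x)\<^sup>2"
      using lim
    proof eventually_elim
      case (elim x)
      then have "(\<lambda>m. (u (m + n) x - u n x)\<^sup>2) \<longlonglongrightarrow> (H x - u n x)\<^sup>2"
        by (intro tendsto_intros) (rule LIMSEQ_ignore_initial_segment)
      then show ?case by (simp add: power2_commute)
    qed
    show "integrable M (\<lambda>x. (u n x - H x)\<^sup>2)" "(\<integral>x. (u n x - H x)\<^sup>2 \<partial>M) \<le> (1/4) ^ n"
      using sqd cauchy[of n] by (auto intro!: integral_le_of_AE_limit[OF _ _ _ l, where C = "(1/4) ^ n"])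
  qed
  have "integrable M (\<lambda>x. (u 0 x + - (u 0 x - H x))\<^sup>2)"
    by (rule square_integrable_add) (use sq fatou(1)[of 0] in \<open>auto simp: power2_commute\<close>)
  then have "integrable M (\<lambda>x. (H x)\<^sup>2)" by simp
  then show ?thesis using H fatou by auto
qed

lemma abs_powr_2: "\<bar>x\<bar> powr 2 = x\<^sup>2" for x :: real
  using powr_realpow[of "\<bar>x\<bar>" 2] by (cases "x = 0") auto

lemma Lr_norm_2: "Lr_norm P 2 f = sqrt (\<integral>x. (f x)\<^sup>2 \<partial>P)"
  by (simp add: Lr_norm_def abs_powr_2 powr_half_sqrt)

context indep_family
begin

lemma Lr_space_2_iff:
  "f \<in> Lr_space P E X 2 \<longleftrightarrow> f \<in> borel_measurable (\<S> UNIV) \<and> integrable P (\<lambda>x. (f x)\<^sup>2)"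
  by (simp add: Lr_space_def abs_powr_2)

text \<open>A Riesz-Fischer argument for an unordered index set. Finite sets that nearly attain the
  supremum of the sums of squared norms replace initial segments: whatever is disjoint from such a
  set contributes at most the missing amount.\<close>

lemma has_L2_sum_orthogonal:
  fixes f :: "'i \<Rightarrow> 'a \<Rightarrow> real"
  assumes f: "\<And>i. i \<in> I \<Longrightarrow> f i \<in> Lr_space P E X 2"
    and orth: "\<And>i j. i \<in> I \<Longrightarrow> j \<in> I \<Longrightarrow> i \<noteq> j \<Longrightarrow> (\<integral>x. f i x * f j x \<partial>P) = 0"
    and bound: "\<And>T. finite T \<Longrightarrow> T \<subseteq> I \<Longrightarrow> (\<Sum>i\<in>T. \<integral>x. (f i x)\<^sup>2 \<partial>P) \<le> B"
  shows "\<exists>H. has_L2_sum P E X f I H"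
proof -
  let ?\<phi> = "\<lambda>i. \<integral>x. (f i x)\<^sup>2 \<partial>P"
  let ?fin = "{T. finite T \<and> T \<subseteq> I}"
  have fS: "f i \<in> borel_measurable (\<S> UNIV)" and fsq: "integrable P (\<lambda>x. (f i x)\<^sup>2)"
    and fP: "f i \<in> borel_measurable P" if "i \<in> I" for i
    using f[OF that] measurable_sigma_of by (auto simp: Lr_space_2_iff)
  have pyth: "(\<integral>x. (\<Sum>i\<in>T. f i x)\<^sup>2 \<partial>P) = (\<Sum>i\<in>T. ?\<phi> i)" if "T \<in> ?fin" for T
    using that by (intro expectation_square_sum_orthogonal) (auto intro!: fP fsq orth)
  have sumsq: "integrable P (\<lambda>x. (\<Sum>i\<in>T. f i x)\<^sup>2)" if "T \<in> ?fin" for T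
    using that by (intro square_integrable_sum) (auto intro!: fP fsq)
  have bdd: "bdd_above (sum ?\<phi> ` ?fin)"
    using bound by (intro bdd_aboveI2[of _ _ B]) auto
  have "\<exists>S\<in>?fin. \<forall>T\<in>?fin. S \<inter> T = {} \<longrightarrow> sum ?\<phi> T \<le> (1/4) ^ n" for n
  proof -
    have "Sup (sum ?\<phi> ` ?fin) - (1/4) ^ n < Sup (sum ?\<phi> ` ?fin)" by simp
    moreover have "sum ?\<phi> ` ?fin \<noteq> {}" by auto
    ultimately obtain y where "y \<in> sum ?\<phi> ` ?fin" "Sup (sum ?\<phi> ` ?fin) - (1/4) ^ n < y"
      by (rule less_cSupE)
    then obtain S where S: "S \<in> ?fin" "Sup (sum ?\<phi> ` ?fin) - (1/4) ^ n < sum ?\<phi> S"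
      by blast
    have "sum ?\<phi> T \<le> (1/4) ^ n" if "T \<in> ?fin" "S \<inter> T = {}" for T
    proof -
      have "sum ?\<phi> (S \<union> T) \<le> Sup (sum ?\<phi> ` ?fin)"
        using S that by (intro cSup_upper bdd imageI) auto
      moreover have "sum ?\<phi> (S \<union> T) = sum ?\<phi> S + sum ?\<phi> T"
        using S that by (intro sum.union_disjoint) auto
      ultimately show ?thesis using S by linarith
    qed
    then show ?thesis using S by blast
  qed
  then have "\<forall>n. \<exists>S. S \<in> ?fin \<and> (\<forall>T\<in>?fin. S \<inter> T = {} \<longrightarrow> sum ?\<phi> T \<le> (1/4) ^ n)"
    unfolding Bex_def by (rule allI)
  from choice[OF this] obtain S where "\<forall>n. S n \<in> ?fin \<and> (\<forall>T\<in>?fin. S n \<inter> T = {} \<longrightarrow> sum ?\<phi> T \<le> (1/4) ^ n)"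
    by (rule exE)
  note choice = this[THEN spec]
  have S: "S n \<in> ?fin" for n by (rule choice[THEN conjunct1])
  have tail: "sum ?\<phi> T \<le> (1/4) ^ n" if "T \<in> ?fin" "S n \<inter> T = {}" for n T
    by (rule choice[THEN conjunct2, THEN bspec, THEN mp]) (fact that)+
  \<comment> \<open>Unions make the sets increase with n, as the Cauchy estimate requires.\<close>
  define R where "R n = (\<Union>k\<le>n. S k)" for n
  define u where "u n x = (\<Sum>i\<in>R n. f i x)" for n x
  have R: "R n \<in> ?fin" for n using S unfolding R_def by auto
  have dist: "(\<integral>x. ((\<Sum>i\<in>T. f i x) - u n x)\<^sup>2 \<partial>P) \<le> (1/4) ^ n"
    "integrable P (\<lambda>x. ((\<Sum>i\<in>T. f i x) - u n x)\<^sup>2)" if T: "T \<in> ?fin" "R n \<subseteq> T" for T n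
  proof -
    have eq: "(\<Sum>i\<in>T. f i x) - u n x = (\<Sum>i\<in>T - R n. f i x)" for x
      using T unfolding u_def by (subst sum_diff) auto
    have "S n \<subseteq> R n" by (auto simp: R_def)
    then show "(\<integral>x. ((\<Sum>i\<in>T. f i x) - u n x)\<^sup>2 \<partial>P) \<le> (1/4) ^ n"
      using T unfolding eq by (subst pyth) (auto intro!: tail)
    show "integrable P (\<lambda>x. ((\<Sum>i\<in>T. f i x) - u n x)\<^sup>2)"
      using T unfolding eq by (intro sumsq) auto
  qed
  have uS: "u n \<in> borel_measurable (\<S> UNIV)" for n
    using R unfolding u_def[abs_def] by (intro borel_measurable_sum) (auto intro!: fS)
  have usq: "integrable P (\<lambda>x. (u n x)\<^sup>2)" for n
    using sumsq[OF R] by (simp only: u_def)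
  have cauchy: "(\<integral>x. (u m x - u n x)\<^sup>2 \<partial>P) \<le> (1/4) ^ n" if "n \<le> m" for m n
  proof -
    have "R n \<subseteq> R m" using that unfolding R_def by (intro UN_mono) auto
    from dist(1)[OF R this] show ?thesis by (simp only: u_def[of m])
  qed
  obtain H where H: "H \<in> borel_measurable (\<S> UNIV)" "integrable P (\<lambda>x. (H x)\<^sup>2)"
    "\<And>n. integrable P (\<lambda>x. (u n x - H x)\<^sup>2)" "\<And>n. (\<integral>x. (u n x - H x)\<^sup>2 \<partial>P) \<le> (1/4) ^ n"
    using L2_Cauchy_limit[OF subalgebra_sigma_of uS usq cauchy] by auto
  note [measurable] = measurable_sigma_of[OF H(1)] measurable_sigma_of[OF uS]
  have close: "(\<integral>x. ((\<Sum>i\<in>T. f i x) - H x)\<^sup>2 \<partial>P) \<le> 4 * (1/4) ^ n" if T: "T \<in> ?fin" "R n \<subseteq> T" for T n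
  proof -
    \<comment> \<open>The difference of the two sides is (a - 2b + c)^2. Two squared distances of at
      most \<open>(1/4) ^ n\<close>, each with weight 2, give the factor 4.\<close>
    have sq: "(a - c)\<^sup>2 \<le> 2 * (a - b)\<^sup>2 + 2 * (b - c)\<^sup>2" for a b c :: real
      using zero_le_power2[of "a - 2 * b + c"] by (simp add: power2_eq_square algebra_simps)
    have [measurable]: "(\<lambda>x. \<Sum>i\<in>T. f i x) \<in> borel_measurable P"
      using T by (intro borel_measurable_sum) (auto intro!: fP)
    have i: "integrable P (\<lambda>x. 2 * ((\<Sum>i\<in>T. f i x) - u n x)\<^sup>2 + 2 * (u n x - H x)\<^sup>2)"
      using dist(2)[OF T] H(3) by auto
    have "(\<integral>x. ((\<Sum>i\<in>T. f i x) - H x)\<^sup>2 \<partial>P) \<le> (\<integral>x. 2 * ((\<Sum>i\<in>T. f i x) - u n x)\<^sup>2 + 2 * (u n x - H x)\<^sup>2 \<partial>P)"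
      using i by (intro integral_mono' sq) auto
    also have "\<dots> = 2 * (\<integral>x. ((\<Sum>i\<in>T. f i x) - u n x)\<^sup>2 \<partial>P) + 2 * (\<integral>x. (u n x - H x)\<^sup>2 \<partial>P)"
      using dist(2)[OF T] H(3) by simp
    also have "\<dots> \<le> 4 * (1/4) ^ n"
      using dist(1)[OF T] H(4)[of n] by linarith
    finally show ?thesis .
  qed
  have "((\<lambda>T. sqrt (\<integral>x. ((\<Sum>i\<in>T. f i x) - H x)\<^sup>2 \<partial>P)) \<longlongrightarrow> sqrt 0) (finite_subsets_at_top I)"
  proof (intro tendsto_real_sqrt tendstoI)
    fix e :: real assume "0 < e"
    then obtain n where n: "(1/4) ^ n < e / 4"
      using real_arch_pow_inv[of "e / 4" "1 / 4"] by auto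
    show "\<forall>\<^sub>F T in finite_subsets_at_top I. dist (\<integral>x. ((\<Sum>i\<in>T. f i x) - H x)\<^sup>2 \<partial>P) 0 < e"
      unfolding eventually_finite_subsets_at_top
    proof (intro exI[of _ "R n"] conjI allI impI)
      fix T assume "finite T \<and> R n \<subseteq> T \<and> T \<subseteq> I"
      then show "dist (\<integral>x. ((\<Sum>i\<in>T. f i x) - H x)\<^sup>2 \<partial>P) 0 < e"
        using close[of T n] n by (auto simp: dist_real_def)
    qed (use R in auto)
  qed
  then have "has_L2_sum P E X f I H"
    using f H(1,2) unfolding has_L2_sum_def Lr_norm_2 by (auto simp: Lr_space_2_iff)
  then show ?thesis by (rule exI[where x = H])
qed

text \<open>Ensures that \<open>SOME\<close> in \<open>OU_pseudo_inverse\<close> picks a genuine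
  sum. The factors 1/|M| are at most 1, so Bessel's inequality for G also bounds this
  series.\<close>

lemma has_L2_sum_OU_pseudo_inverse:
  assumes G: "G \<in> Lr_space P E X 2"
  shows "has_L2_sum P E X (\<lambda>M \<omega>. - (1 / real (card M)) * hc G M \<omega>) {M. finite M \<and> M \<noteq> {}}
           (OU_pseudo_inverse P E X G)"
proof -
  have "\<exists>H. has_L2_sum P E X (\<lambda>M \<omega>. - (1 / real (card M)) * hc G M \<omega>) {M. finite M \<and> M \<noteq> {}} H"
  proof (rule has_L2_sum_orthogonal)
    have G': "G \<in> borel_measurable P" "integrable P (\<lambda>x. (G x)\<^sup>2)"
      using G measurable_sigma_of by (auto simp: Lr_space_2_iff)
    fix M :: "nat set" assume M: "M \<in> {M. finite M \<and> M \<noteq> {}}"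
    show "(\<lambda>\<omega>. - (1 / real (card M)) * hc G M \<omega>) \<in> Lr_space P E X 2"
      unfolding Lr_space_2_iff power_mult_distrib power2_minus
      by (intro conjI borel_measurable_times borel_measurable_const integrable_mult_right
          square_integrable_hc[OF G'] measurable_sigma_of_mono[OF hc_measurable_sigma_of] subset_UNIV)
    fix N assume "N \<in> {M. finite M \<and> M \<noteq> {}}" "M \<noteq> N"
    then show "(\<integral>x. (- (1 / real (card M)) * hc G M x) * (- (1 / real (card N)) * hc G N x) \<partial>P) = 0"
      using hc_orthogonal[OF G', of M N] M by simp
  next
    have G': "G \<in> borel_measurable P" "integrable P (\<lambda>x. (G x)\<^sup>2)"
      using G measurable_sigma_of by (auto simp: Lr_space_2_iff)
    fix T assume T: "finite T" "T \<subseteq> {M::nat set. finite M \<and> M \<noteq> {}}"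
    have "(\<Sum>M\<in>T. \<integral>x. (- (1 / real (card M)) * hc G M x)\<^sup>2 \<partial>P) \<le> (\<Sum>M\<in>T. \<integral>x. (hc G M x)\<^sup>2 \<partial>P)"
    proof (rule sum_mono)
      fix M assume "M \<in> T"
      then have "card M \<noteq> 0" using T by auto
      then have "(1 / real (card M))\<^sup>2 \<le> 1" by (simp add: power_le_one)
      then have "(1 / real (card M))\<^sup>2 * (\<integral>x. (hc G M x)\<^sup>2 \<partial>P) \<le> (\<integral>x. (hc G M x)\<^sup>2 \<partial>P)"
        by (intro mult_left_le_one_le) auto
      then show "(\<integral>x. (- (1 / real (card M)) * hc G M x)\<^sup>2 \<partial>P) \<le> (\<integral>x. (hc G M x)\<^sup>2 \<partial>P)"
        unfolding power_mult_distrib power2_minus by simp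
    qed
    also have "\<dots> \<le> (\<integral>x. (G x)\<^sup>2 \<partial>P)"
      using T by (intro hc_Bessel[OF G']) auto
    finally show "(\<Sum>M\<in>T. \<integral>x. (- (1 / real (card M)) * hc G M x)\<^sup>2 \<partial>P) \<le> (\<integral>x. (G x)\<^sup>2 \<partial>P)" .
  qed
  then show ?thesis
    unfolding OU_pseudo_inverse_def by (rule someI_ex)
qed

end

subsection \<open>Iterated differences\<close>

lemma (in prob_space) integrable_of_abs_powr:
  fixes f :: "'a \<Rightarrow> real"
  assumes "1 \<le> r" "f \<in> borel_measurable M" "integrable M (\<lambda>x. \<bar>f x\<bar> powr r)"
  shows "integrable M f"
proof (rule Bochner_Integration.integrable_bound)
  show "integrable M (\<lambda>x. 1 + \<bar>f x\<bar> powr r)" using assms by simp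
  have "\<bar>y\<bar> \<le> 1 + \<bar>y\<bar> powr r" for y :: real
  proof (cases "\<bar>y\<bar> \<le> 1")
    case True
    then show ?thesis using powr_ge_zero[of "\<bar>y\<bar>" r] by linarith
  next
    case False
    then show ?thesis using powr_mono[of 1 r "\<bar>y\<bar>"] assms(1) by auto
  qed
  then show "AE x in M. norm (f x) \<le> norm (1 + \<bar>f x\<bar> powr r)" by (simp add: add_nonneg_nonneg)
qed (use assms in auto)

lemma integrable_abs_powr_diff:
  fixes f g :: "'a \<Rightarrow> real"
  assumes r: "1 \<le> r" and [measurable]: "f \<in> borel_measurable M" "g \<in> borel_measurable M"
    and "integrable M (\<lambda>x. \<bar>f x\<bar> powr r)" "integrable M (\<lambda>x. \<bar>g x\<bar> powr r)"
  shows "integrable M (\<lambda>x. \<bar>f x - g x\<bar> powr r)"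
proof (rule Bochner_Integration.integrable_bound)
  show "integrable M (\<lambda>x. 2 powr r * (\<bar>f x\<bar> powr r + \<bar>g x\<bar> powr r))" using assms by simp
  have "\<bar>a - b\<bar> powr r \<le> 2 powr r * (\<bar>a\<bar> powr r + \<bar>b\<bar> powr r)" for a b :: real
  proof -
    have "\<bar>a - b\<bar> powr r \<le> (2 * max \<bar>a\<bar> \<bar>b\<bar>) powr r"
      using r by (intro powr_mono2) auto
    also have "\<dots> = 2 powr r * max \<bar>a\<bar> \<bar>b\<bar> powr r" by (simp add: powr_mult)
    also have "\<dots> \<le> 2 powr r * (\<bar>a\<bar> powr r + \<bar>b\<bar> powr r)"
      by (intro mult_left_mono) (auto simp: max_def)
    finally show ?thesis .
  qed
  then show "AE x in M. norm (\<bar>f x - g x\<bar> powr r) \<le> norm (2 powr r * (\<bar>f x\<bar> powr r + \<bar>g x\<bar> powr r))"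
    by (simp add: add_nonneg_nonneg)
qed auto

context indep_family
begin

lemma cond_exp_abs_powr:
  assumes r: "1 \<le> r" and F: "F \<in> borel_measurable P" "integrable P (\<lambda>x. \<bar>F x\<bar> powr r)"
  shows "integrable P (\<lambda>x. \<bar>ce J F x\<bar> powr r)" "(\<integral>x. \<bar>ce J F x\<bar> powr r \<partial>P) \<le> (\<integral>x. \<bar>F x\<bar> powr r \<partial>P)"
  using cond_exp_convex_contraction[OF integrable_of_abs_powr[OF r F] F(2) convex_on_abs_powr[OF r]]
  by auto

lemma cond_exp_L1:
  assumes F: "integrable P F"
  shows "(\<integral>x. \<bar>ce J F x\<bar> \<partial>P) \<le> (\<integral>x. \<bar>F x\<bar> \<partial>P)"
  using cond_exp_abs_powr(2)[of 1 F J] F by simp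

text \<open>Jensen's inequality twice: pointwise for the weights, and for each conditional
  expectation. Every term has the same bound, so the sets \<open>J i\<close> may vary
  freely.\<close>

lemma weighted_cond_exp_abs_powr:
  assumes r: "1 \<le> r" and F: "F \<in> borel_measurable P" "integrable P (\<lambda>x. \<bar>F x\<bar> powr r)"
    and S: "finite S" "\<And>i. i \<in> S \<Longrightarrow> 0 \<le> a i" "sum a S = 1"
  shows "integrable P (\<lambda>x. \<bar>\<Sum>i\<in>S. a i * ce (J i) F x\<bar> powr r)"
    "(\<integral>x. \<bar>\<Sum>i\<in>S. a i * ce (J i) F x\<bar> powr r \<partial>P) \<le> (\<integral>x. \<bar>F x\<bar> powr r \<partial>P)"
proof -
  have S': "S \<noteq> {}" using S by auto
  have pt: "\<bar>\<Sum>i\<in>S. a i * ce (J i) F x\<bar> powr r \<le> (\<Sum>i\<in>S. a i * \<bar>ce (J i) F x\<bar> powr r)" for x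
    using convex_on_sum[OF S(1) S' convex_on_abs_powr[OF r] S(3) S(2), of "\<lambda>i. ce (J i) F x"] by simp
  have i: "integrable P (\<lambda>x. \<Sum>i\<in>S. a i * \<bar>ce (J i) F x\<bar> powr r)"
    by (intro Bochner_Integration.integrable_sum integrable_mult_right cond_exp_abs_powr r F)
  show i2: "integrable P (\<lambda>x. \<bar>\<Sum>i\<in>S. a i * ce (J i) F x\<bar> powr r)"
  proof (rule Bochner_Integration.integrable_bound[OF i])
    show "AE x in P. norm (\<bar>\<Sum>i\<in>S. a i * ce (J i) F x\<bar> powr r) \<le> norm (\<Sum>i\<in>S. a i * \<bar>ce (J i) F x\<bar> powr r)"
      using pt by (intro AE_I2) (auto intro: order_trans[OF _ abs_ge_self])
  qed auto
  have "(\<integral>x. \<bar>\<Sum>i\<in>S. a i * ce (J i) F x\<bar> powr r \<partial>P) \<le> (\<integral>x. (\<Sum>i\<in>S. a i * \<bar>ce (J i) F x\<bar> powr r) \<partial>P)"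
    by (rule integral_mono[OF i2 i pt])
  also have "\<dots> = (\<Sum>i\<in>S. a i * (\<integral>x. \<bar>ce (J i) F x\<bar> powr r \<partial>P))"
    using cond_exp_abs_powr(1)[OF r F] by simp
  also have "\<dots> \<le> (\<Sum>i\<in>S. a i * (\<integral>x. \<bar>F x\<bar> powr r \<partial>P))"
    using S by (intro sum_mono mult_left_mono cond_exp_abs_powr(2)[OF r F]) auto
  also have "\<dots> = (\<integral>x. \<bar>F x\<bar> powr r \<partial>P)"
    using S by (simp flip: sum_distrib_right)
  finally show "(\<integral>x. \<bar>\<Sum>i\<in>S. a i * ce (J i) F x\<bar> powr r \<partial>P) \<le> (\<integral>x. \<bar>F x\<bar> powr r \<partial>P)" .
qed

lemma D_Nil [simp]: "D [] F = F"
  by (simp add: iterated_D_def)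

lemma D_Cons: "D (k # ks) F = (\<lambda>x. D ks F x - ce (- {k}) (D ks F) x)"
  by (auto simp: iterated_D_def malliavin_D_def fun_eq_iff)

lemma D_measurable_sigma_of:
  "F \<in> borel_measurable (\<S> UNIV) \<Longrightarrow> D ks F \<in> borel_measurable (\<S> UNIV)"
  by (induction ks)
     (auto simp: D_Cons intro!: borel_measurable_diff intro: measurable_sigma_of_mono[OF borel_measurable_cond_exp])

lemma D_measurable [measurable]: "F \<in> borel_measurable P \<Longrightarrow> D ks F \<in> borel_measurable P"
  by (induction ks) (auto simp: D_Cons intro!: borel_measurable_diff)

lemma integrable_D: "integrable P F \<Longrightarrow> integrable P (D ks F)"
  by (induction ks) (auto simp: D_Cons intro!: Bochner_Integration.integrable_diff ce.real_cond_exp_int)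

lemma integrable_abs_powr_D:
  assumes r: "1 \<le> r" and F: "F \<in> borel_measurable P" "integrable P (\<lambda>x. \<bar>F x\<bar> powr r)"
  shows "integrable P (\<lambda>x. \<bar>D ks F x\<bar> powr r)"
proof (induction ks)
  case (Cons k ks)
  then show ?case unfolding D_Cons
    using F by (intro integrable_abs_powr_diff cond_exp_abs_powr(1) r) auto
qed (simp add: F)

text \<open>Each difference is the identity minus an \<open>L\<^sup>1\<close> contraction and costs
  a factor 2. The crude constant is harmless, as the bound only transports convergence.\<close>

lemma D_L1:
  assumes F: "integrable P F"
  shows "(\<integral>x. \<bar>D ks F x\<bar> \<partial>P) \<le> 2 ^ length ks * (\<integral>x. \<bar>F x\<bar> \<partial>P)"
proof (induction ks)
  case (Cons k ks)
  let ?W = "D ks F"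
  have W: "integrable P ?W" by (rule integrable_D[OF F])
  have cW: "integrable P (ce (- {k}) ?W)" by (rule ce.real_cond_exp_int(1)[OF W])
  have "(\<integral>x. \<bar>D (k # ks) F x\<bar> \<partial>P) \<le> (\<integral>x. \<bar>?W x\<bar> + \<bar>ce (- {k}) ?W x\<bar> \<partial>P)"
    unfolding D_Cons using W cW by (intro integral_mono) auto
  also have "\<dots> = (\<integral>x. \<bar>?W x\<bar> \<partial>P) + (\<integral>x. \<bar>ce (- {k}) ?W x\<bar> \<partial>P)"
    using W cW by simp
  finally show ?case using cond_exp_L1[OF W, of "- {k}"] Cons by simp
qed simp

lemma D_cong_AE:
  assumes "F \<in> borel_measurable P" "G \<in> borel_measurable P" "AE x in P. F x = G x"
  shows "AE x in P. D ks F x = D ks G x"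
proof (induction ks)
  case (Cons k ks)
  have "AE x in P. ce (- {k}) (D ks F) x = ce (- {k}) (D ks G) x"
    using assms by (intro ce.real_cond_exp_cong Cons) auto
  then show ?case using Cons by eventually_elim (simp add: D_Cons)
qed (simp add: assms)

lemma D_sum:
  assumes f: "\<And>i. i \<in> I \<Longrightarrow> integrable P (f i)"
  shows "AE x in P. D ks (\<lambda>x. \<Sum>i\<in>I. a i * f i x) x = (\<Sum>i\<in>I. a i * D ks (f i) x)"
proof (cases "finite I")
  case True
  show ?thesis
  proof (induction ks)
    case (Cons k ks)
    have i: "integrable P (D ks (f i))" if "i \<in> I" for i using f[OF that] by (rule integrable_D)
    have "AE x in P. ce (- {k}) (D ks (\<lambda>x. \<Sum>i\<in>I. a i * f i x)) x
       = ce (- {k}) (\<lambda>x. \<Sum>i\<in>I. a i * D ks (f i) x) x"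
      by (rule ce.real_cond_exp_cong[OF Cons])
        (auto intro!: D_measurable borel_measurable_sum borel_measurable_times borel_measurable_integrable[OF f])
    moreover have "AE x in P. ce (- {k}) (\<lambda>x. \<Sum>i\<in>I. a i * D ks (f i) x) x
       = (\<Sum>i\<in>I. ce (- {k}) (\<lambda>x. a i * D ks (f i) x) x)"
      using i by (intro cond_exp_sum) auto
    moreover have "AE x in P. \<forall>i\<in>I. ce (- {k}) (\<lambda>x. a i * D ks (f i) x) x = a i * ce (- {k}) (D ks (f i)) x"
      using True i by (intro AE_finite_allI) auto
    ultimately show ?case
      using Cons by eventually_elim (simp add: D_Cons sum_subtractf right_diff_distrib)
  qed simp
next
  case False
  \<comment> \<open>A sum over an infinite index set is 0 by convention, so only differences of the
    zero function remain.\<close>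
  have "AE x in P. D ks (\<lambda>x. 0) x = 0"
  proof (induction ks)
    case (Cons k ks)
    have "AE x in P. ce (- {k}) (D ks (\<lambda>x. 0)) x = ce (- {k}) (\<lambda>x. 0) x"
      by (rule ce.real_cond_exp_cong[OF Cons]) auto
    moreover have "AE x in P. ce (- {k}) (\<lambda>x. 0) x = 0"
      by (rule ce.real_cond_exp_F_meas) auto
    ultimately show ?case using Cons by eventually_elim (simp add: D_Cons)
  qed simp
  then show ?thesis using False by simp
qed

lemma D_diff:
  assumes "integrable P F" "integrable P G"
  shows "AE x in P. D ks (\<lambda>x. F x - G x) x = D ks F x - D ks G x"
  using D_sum[of "{True, False}" "\<lambda>b. if b then F else G" ks "\<lambda>b. if b then 1 else - 1"] assms
  by simp

text \<open>Both orders of \<open>ce A\<close> and \<open>ce (- {k})\<close> amount to conditioning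
  on \<open>A - {k}\<close>. The commutation allows \<open>D ks H\<close> to be studied on finitely
  many coordinates at a time.\<close>

lemma D_cond_exp:
  assumes F: "integrable P F"
  shows "AE x in P. ce A (D ks F) x = D ks (ce A F) x"
proof (induction ks)
  case (Cons k ks)
  have W: "integrable P (D ks F)" by (rule integrable_D[OF F])
  have cW: "integrable P (ce (- {k}) (D ks F))" by (rule ce.real_cond_exp_int(1)[OF W])
  have "AE x in P. ce A (D (k # ks) F) x = ce A (D ks F) x - ce A (ce (- {k}) (D ks F)) x"
    unfolding D_Cons by (rule ce.real_cond_exp_diff[OF W cW])
  moreover have "AE x in P. ce (- {k}) (ce A (D ks F)) x = ce (- {k}) (D ks (ce A F)) x"
    using F by (intro ce.real_cond_exp_cong Cons) auto
  ultimately show ?case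
    using Cons cond_exp_cond_exp[OF W, of A "- {k}"] cond_exp_cond_exp[OF W, of "- {k}" A]
    by eventually_elim (simp add: D_Cons Int_commute)
qed simp

text \<open>\<open>ce (- {k})\<close> fixes the component of M when k is not in M and annihilates it
  otherwise; subtracting it from the identity selects the components whose index set contains
  k.\<close>

lemma D_hc:
  assumes F: "integrable P F" and M: "finite M"
  shows "AE x in P. D ks (hc F M) x = (if set ks \<subseteq> M then hc F M x else 0)"
proof (induction ks)
  case (Cons k ks)
  let ?g = "\<lambda>x. if set ks \<subseteq> M then hc F M x else 0"
  have "AE x in P. ce (- {k}) (D ks (hc F M)) x = ce (- {k}) ?g x"
    by (rule ce.real_cond_exp_cong[OF Cons]) auto
  moreover have "AE x in P. ce (- {k}) ?g x = (if k \<in> M then 0 else ?g x)"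
  proof (cases "set ks \<subseteq> M")
    case True
    then show ?thesis using cond_exp_hc[OF F M, of "- {k}"] by (auto simp: subset_Compl_singleton)
  next
    case False
    have "AE x in P. ce (- {k}) (\<lambda>x. 0) x = 0" by (rule ce.real_cond_exp_F_meas) auto
    then show ?thesis using False by simp
  qed
  ultimately show ?case using Cons by eventually_elim (auto simp: D_Cons)
qed simp

lemma D_const: "AE x in P. D ks (\<lambda>_. c) x = (if ks = [] then c else 0)"
proof (induction ks)
  case (Cons k ks)
  let ?c = "if ks = [] then c else 0"
  have "AE x in P. ce (- {k}) (D ks (\<lambda>_. c)) x = ce (- {k}) (\<lambda>_. ?c) x"
    by (rule ce.real_cond_exp_cong[OF Cons]) auto
  moreover have "AE x in P. ce (- {k}) (\<lambda>_. ?c) x = ?c"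
    by (rule ce.real_cond_exp_F_meas) auto
  ultimately show ?case using Cons by eventually_elim (auto simp: D_Cons)
qed simp

text \<open>Removes the centering: the bound can be stated with F although the pseudo-inverse is
  applied to F minus its expectation.\<close>

lemma D_diff_const:
  assumes "integrable P F" "ks \<noteq> []"
  shows "AE x in P. D ks (\<lambda>x. F x - c) x = D ks F x"
proof -
  have "AE x in P. D ks (\<lambda>x. F x - c) x = D ks F x - D ks (\<lambda>_. c) x"
    by (rule D_diff) (auto simp: assms)
  then show ?thesis using D_const[of ks c] by eventually_elim (simp add: assms)
qed

end

subsection \<open>Conditional expectations of the pseudo-inverse\<close>

context indep_family
begin

lemma has_L2_sum_integrable:
  assumes "has_L2_sum P E X f I H"
  shows "H \<in> borel_measurable (\<S> UNIV)" "integrable P (\<lambda>x. (H x)\<^sup>2)" "integrable P H"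
    and "i \<in> I \<Longrightarrow> integrable P (\<lambda>x. (f i x)\<^sup>2)" "i \<in> I \<Longrightarrow> integrable P (f i)"
  using assms unfolding has_L2_sum_def Lr_space_2_iff
  by (auto intro: square_integrable_imp_integrable measurable_sigma_of)

text \<open>An epsilon form of the net convergence. Since the threshold S works for all larger
  finite T, it can be enlarged by any finite set that a later argument needs.\<close>

lemma has_L2_sum_L1:
  assumes H: "has_L2_sum P E X f I H" and e: "0 < e"
  shows "\<exists>S. finite S \<and> S \<subseteq> I \<and>
    (\<forall>T. finite T \<and> S \<subseteq> T \<and> T \<subseteq> I \<longrightarrow> (\<integral>x. \<bar>(\<Sum>i\<in>T. f i x) - H x\<bar> \<partial>P) < e)"
proof -
  note i = has_L2_sum_integrable[OF H]
  have "((\<lambda>S. sqrt (\<integral>x. ((\<Sum>i\<in>S. f i x) - H x)\<^sup>2 \<partial>P)) \<longlongrightarrow> 0) (finite_subsets_at_top I)"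
    using H unfolding has_L2_sum_def Lr_norm_2 by simp
  then have "\<forall>\<^sub>F S in finite_subsets_at_top I. sqrt (\<integral>x. ((\<Sum>i\<in>S. f i x) - H x)\<^sup>2 \<partial>P) < e"
    by (rule order_tendstoD(2)) (rule e)
  moreover have "(\<integral>x. \<bar>(\<Sum>i\<in>T. f i x) - H x\<bar> \<partial>P) < e"
    if T: "finite T" "T \<subseteq> I" and less: "sqrt (\<integral>x. ((\<Sum>i\<in>T. f i x) - H x)\<^sup>2 \<partial>P) < e" for T
  proof -
    have m: "f i \<in> borel_measurable P" if "i \<in> T" for i
      using i(5) that T by blast
    have mH: "H \<in> borel_measurable P" using i(3) by auto
    have "integrable P (\<lambda>x. ((\<Sum>i\<in>T. f i x) + - H x)\<^sup>2)"
      by (rule square_integrable_add)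
        (use i(2,4) T m mH in \<open>auto intro!: square_integrable_sum borel_measurable_sum\<close>)
    then have "(\<integral>x. \<bar>(\<Sum>i\<in>T. f i x) - H x\<bar> \<partial>P) \<le> sqrt (\<integral>x. ((\<Sum>i\<in>T. f i x) - H x)\<^sup>2 \<partial>P)"
      using m mH by (intro abs_expectation_le_sqrt) (auto intro!: borel_measurable_diff borel_measurable_sum)
    then show ?thesis using less by simp
  qed
  ultimately show ?thesis
    unfolding eventually_finite_subsets_at_top by (elim ex_forward) auto
qed

text \<open>For T containing J, \<open>ce A\<close> maps the partial sum over T to exactly the sum
  over J, while T can be chosen within any e of H in \<open>L\<^sup>1\<close>. Contraction then
  bounds the distance of the two sides by e.\<close>

lemma cond_exp_L2_sum:
  assumes H: "has_L2_sum P E X f I H" and J: "finite J" "J \<subseteq> I"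
    and f: "\<And>i. i \<in> I \<Longrightarrow> AE x in P. ce A (f i) x = (if i \<in> J then f i x else 0)"
  shows "AE x in P. ce A H x = (\<Sum>i\<in>J. f i x)"
proof -
  note i = has_L2_sum_integrable[OF H]
  let ?h = "\<lambda>x. \<bar>(\<Sum>i\<in>J. f i x) - ce A H x\<bar>"
  have ih: "integrable P ?h"
    using J i by (intro integrable_abs Bochner_Integration.integrable_diff
        Bochner_Integration.integrable_sum ce.real_cond_exp_int(1)) auto
  have "(\<integral>x. ?h x \<partial>P) \<le> e" if "0 < e" for e
  proof -
    obtain S where S: "finite S" "S \<subseteq> I"
      "\<forall>T. finite T \<and> S \<subseteq> T \<and> T \<subseteq> I \<longrightarrow> (\<integral>x. \<bar>(\<Sum>i\<in>T. f i x) - H x\<bar> \<partial>P) < e"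
      using has_L2_sum_L1[OF H \<open>0 < e\<close>] by (elim exE conjE)
    let ?T = "S \<union> J"
    have T: "finite ?T" "?T \<subseteq> I" using S J by auto
    have iT: "integrable P (\<lambda>x. \<Sum>i\<in>?T. f i x)"
      using T i(5) by (intro Bochner_Integration.integrable_sum) auto
    have "AE x in P. ce A (\<lambda>x. \<Sum>i\<in>?T. f i x) x = (\<Sum>i\<in>?T. ce A (f i) x)"
      using T i(5) by (intro cond_exp_sum) auto
    moreover have "AE x in P. \<forall>i\<in>?T. ce A (f i) x = (if i \<in> J then f i x else 0)"
    proof (rule AE_finite_allI[OF T(1)])
      fix i assume "i \<in> ?T"
      then have "i \<in> I" using T(2) by blast
      then show "AE x in P. ce A (f i) x = (if i \<in> J then f i x else 0)" by (rule f)
    qed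
    moreover have "AE x in P. ce A (\<lambda>x. (\<Sum>i\<in>?T. f i x) - H x) x = ce A (\<lambda>x. \<Sum>i\<in>?T. f i x) x - ce A H x"
      using iT i(3) by (rule ce.real_cond_exp_diff)
    ultimately have "AE x in P. ?h x = \<bar>ce A (\<lambda>x. (\<Sum>i\<in>?T. f i x) - H x) x\<bar>"
    proof eventually_elim
      case (elim x)
      have "(\<Sum>i\<in>?T. if i \<in> J then f i x else 0) = (\<Sum>i\<in>J. f i x)"
        using T by (simp add: sum.If_cases Int_absorb1)
      then show ?case using elim by simp
    qed
    then have "(\<integral>x. ?h x \<partial>P) = (\<integral>x. \<bar>ce A (\<lambda>x. (\<Sum>i\<in>?T. f i x) - H x) x\<bar> \<partial>P)"
      using ih by (intro integral_cong_AE) auto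
    also have "\<dots> \<le> (\<integral>x. \<bar>(\<Sum>i\<in>?T. f i x) - H x\<bar> \<partial>P)"
      using iT i(3) by (intro cond_exp_L1) auto
    also have "\<dots> < e" using T S(3) by auto
    finally show ?thesis by simp
  qed
  then have "(\<integral>x. ?h x \<partial>P) \<le> 0" by (rule field_le_epsilon[of _ 0, simplified])
  moreover have "(\<integral>x. ?h x \<partial>P) \<ge> 0" by (rule Bochner_Integration.integral_nonneg) simp
  ultimately have "AE x in P. ?h x = 0"
    using integral_nonneg_eq_0_iff_AE[OF ih] by simp
  then show ?thesis by eventually_elim simp
qed

text \<open>A finite partial sum close to H is eventually fixed by \<open>ce (A n)\<close>; the
  remainder costs at most \<open>e / 2\<close> before and after conditioning.\<close>

lemma cond_exp_L2_sum_tendsto: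
  fixes f :: "'i \<Rightarrow> 'a \<Rightarrow> real"
  assumes H: "has_L2_sum P E X f I H"
    and f: "\<And>i. i \<in> I \<Longrightarrow> \<forall>\<^sub>F n in sequentially. AE x in P. ce (A n) (f i) x = f i x"
  shows "(\<lambda>n. \<integral>x. \<bar>ce (A n) H x - H x\<bar> \<partial>P) \<longlonglongrightarrow> 0"
proof (rule LIMSEQ_I)
  note i = has_L2_sum_integrable[OF H]
  fix e :: real assume "0 < e"
  then have e: "0 < e / 2" by simp
  obtain S where S: "finite S" "S \<subseteq> I"
    "\<forall>T. finite T \<and> S \<subseteq> T \<and> T \<subseteq> I \<longrightarrow> (\<integral>x. \<bar>(\<Sum>i\<in>T. f i x) - H x\<bar> \<partial>P) < e / 2"
    using has_L2_sum_L1[OF H e] by (elim exE conjE)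
  let ?s = "\<lambda>x. \<Sum>i\<in>S. f i x"
  have intS: "integrable P ?s"
    using S i(5) by (intro Bochner_Integration.integrable_sum) auto
  have "\<forall>\<^sub>F n in sequentially. \<forall>i\<in>S. AE x in P. ce (A n) (f i) x = f i x"
    using S f by (intro eventually_ball_finite) auto
  then obtain N where N: "\<And>n i. n \<ge> N \<Longrightarrow> i \<in> S \<Longrightarrow> AE x in P. ce (A n) (f i) x = f i x"
    unfolding eventually_sequentially by blast
  have "(\<integral>x. \<bar>ce (A n) H x - H x\<bar> \<partial>P) < e" if "n \<ge> N" for n
  proof -
    have isH: "integrable P (\<lambda>x. ?s x - H x)" using intS i(3) by auto
    have icH: "integrable P (ce (A n) H)" by (rule ce.real_cond_exp_int(1)[OF i(3)])
    have icsH: "integrable P (ce (A n) (\<lambda>x. ?s x - H x))" by (rule ce.real_cond_exp_int(1)[OF isH])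
    have "AE x in P. ce (A n) ?s x = (\<Sum>i\<in>S. ce (A n) (f i) x)"
      using S i(5) by (intro cond_exp_sum) auto
    moreover have "AE x in P. \<forall>i\<in>S. ce (A n) (f i) x = f i x"
      using S N[OF that] by (intro AE_finite_allI) auto
    moreover have "AE x in P. ce (A n) (\<lambda>x. ?s x - H x) x = ce (A n) ?s x - ce (A n) H x"
      using intS i(3) by (rule ce.real_cond_exp_diff)
    ultimately have "AE x in P. \<bar>ce (A n) H x - H x\<bar> \<le> \<bar>ce (A n) (\<lambda>x. ?s x - H x) x\<bar> + \<bar>?s x - H x\<bar>"
      by eventually_elim simp
    then have "(\<integral>x. \<bar>ce (A n) H x - H x\<bar> \<partial>P) \<le> (\<integral>x. \<bar>ce (A n) (\<lambda>x. ?s x - H x) x\<bar> + \<bar>?s x - H x\<bar> \<partial>P)"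
      using i(3) icH icsH isH by (intro integral_mono_AE) auto
    also have "\<dots> = (\<integral>x. \<bar>ce (A n) (\<lambda>x. ?s x - H x) x\<bar> \<partial>P) + (\<integral>x. \<bar>?s x - H x\<bar> \<partial>P)"
      using icsH isH by (intro Bochner_Integration.integral_add integrable_abs)
    also have "\<dots> < e" using cond_exp_L1[OF isH, of "A n"] S by auto
    finally show ?thesis .
  qed
  moreover have "0 \<le> (\<integral>x. \<bar>ce (A n) H x - H x\<bar> \<partial>P)" for n
    by (rule Bochner_Integration.integral_nonneg) simp
  ultimately show "\<exists>N. \<forall>n\<ge>N. norm ((\<integral>x. \<bar>ce (A n) H x - H x\<bar> \<partial>P) - 0) < e"
    by (intro exI[of _ N]) simp
qed

text \<open>With K = \<open>set ks\<close>, both sides are combinations of the components of K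
  \<union> J for J \<subseteq> N. On the right this component occurs in the term of L exactly when J
  \<subseteq> L, so its coefficient is minus the sum of \<open>c L\<close> over these L; the
  hypothesis on c matches it with the left-hand side.\<close>

lemma cond_exp_D_OU:
  assumes G: "integrable P G"
    and H: "has_L2_sum P E X (\<lambda>M \<omega>. - (1 / real (card M)) * hc G M \<omega>) {M. finite M \<and> M \<noteq> {}} H"
    and ks: "distinct ks" "ks \<noteq> []" and N: "finite N" "N \<inter> set ks = {}"
    and c: "\<And>J. J \<subseteq> N \<Longrightarrow> (\<Sum>L\<in>{L. J \<subseteq> L \<and> L \<subseteq> N}. c L) = 1 / (length ks + card J)"
  shows "AE x in P. ce (set ks \<union> N) (D ks H) x = - (\<Sum>L\<in>Pow N. c L * ce (set ks \<union> L) (D ks G) x)"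
proof -
  let ?K = "set ks" let ?A = "?K \<union> N"
  let ?I = "{M::nat set. finite M \<and> M \<noteq> {}}"
  let ?J = "Pow ?A - {{}}"
  have A: "finite ?A" using N by simp
  have finL: "finite L" "L \<inter> ?K = {}" if "L \<in> Pow N" for L
    using that N by (auto intro: finite_subset)
  have iH: "integrable P H" using has_L2_sum_integrable(3)[OF H] .
  have ihc: "integrable P (hc G M)" for M by (rule integrable_hc[OF G])
  have reindex: "(\<Sum>M\<in>Pow (?K \<union> L). if ?K \<subseteq> M then g M else 0) = (\<Sum>J\<in>Pow L. g (?K \<union> J))"
    if L: "L \<in> Pow N" for L and g :: "nat set \<Rightarrow> real"
  proof -
    have "(\<Sum>M\<in>Pow (?K \<union> L). if ?K \<subseteq> M then g M else 0) = (\<Sum>M\<in>{M \<in> Pow (?K \<union> L). ?K \<subseteq> M}. g M)"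
      using finL[OF L] by (intro sum.inter_filter[symmetric]) auto
    also have "\<dots> = (\<Sum>J\<in>Pow L. g (?K \<union> J))"
      by (rule sum.reindex_bij_witness[where i = "\<lambda>J. ?K \<union> J" and j = "\<lambda>M. M - ?K"])
         (use finL[OF L] in \<open>auto simp: Un_absorb1\<close>)
    finally show ?thesis .
  qed
  have "AE x in P. ce ?A H x = (\<Sum>M\<in>?J. - (1 / real (card M)) * hc G M x)"
  proof (rule cond_exp_L2_sum[OF H])
    fix M :: "nat set" assume M: "M \<in> ?I"
    have "AE x in P. ce ?A (\<lambda>x. - (1 / real (card M)) * hc G M x) x = - (1 / real (card M)) * ce ?A (hc G M) x"
      by (rule ce.real_cond_exp_cmult[OF ihc])
    moreover have "AE x in P. ce ?A (hc G M) x = (if M \<subseteq> ?A then hc G M x else 0)"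
      using M by (intro cond_exp_hc[OF G]) auto
    ultimately show "AE x in P. ce ?A (\<lambda>x. - (1 / real (card M)) * hc G M x) x
        = (if M \<in> ?J then - (1 / real (card M)) * hc G M x else 0)"
      by eventually_elim (use M in auto)
  qed (use A in \<open>auto intro: finite_subset\<close>)
  then have "AE x in P. D ks (ce ?A H) x = D ks (\<lambda>x. \<Sum>M\<in>?J. - (1 / real (card M)) * hc G M x) x"
    by (rule D_cong_AE[rotated 2]) auto
  moreover have "AE x in P. D ks (\<lambda>x. \<Sum>M\<in>?J. - (1 / real (card M)) * hc G M x) x
      = (\<Sum>M\<in>?J. - (1 / real (card M)) * D ks (hc G M) x)"
    by (rule D_sum[OF ihc])
  moreover have D_hc_all: "AE x in P. \<forall>M\<in>Pow ?A. D ks (hc G M) x = (if ?K \<subseteq> M then hc G M x else 0)"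
    using A by (intro AE_finite_allI D_hc[OF G]) (auto intro: finite_subset)
  moreover have "AE x in P. \<forall>L\<in>Pow N. ce (?K \<union> L) (D ks G) x = (\<Sum>J\<in>Pow L. hc G (?K \<union> J) x)"
  proof (rule AE_finite_allI)
    fix L assume L: "L \<in> Pow N"
    have "ce (?K \<union> L) G = (\<lambda>x. \<Sum>M\<in>Pow (?K \<union> L). 1 * hc G M x)"
      using finL[OF L] by (simp add: sum_hc)
    then have "AE x in P. ce (?K \<union> L) (D ks G) x = D ks (\<lambda>x. \<Sum>M\<in>Pow (?K \<union> L). 1 * hc G M x) x"
      using D_cond_exp[OF G, of "?K \<union> L" ks] by simp
    moreover have "AE x in P. D ks (\<lambda>x. \<Sum>M\<in>Pow (?K \<union> L). 1 * hc G M x) x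
        = (\<Sum>M\<in>Pow (?K \<union> L). 1 * D ks (hc G M) x)"
      by (rule D_sum[OF ihc])
    ultimately show "AE x in P. ce (?K \<union> L) (D ks G) x = (\<Sum>J\<in>Pow L. hc G (?K \<union> J) x)"
      using D_hc_all
    proof eventually_elim
      case (elim x)
      have "(\<Sum>M\<in>Pow (?K \<union> L). 1 * D ks (hc G M) x) = (\<Sum>M\<in>Pow (?K \<union> L). if ?K \<subseteq> M then hc G M x else 0)"
      proof (rule sum.cong[OF refl])
        fix M assume "M \<in> Pow (?K \<union> L)"
        then have "M \<in> Pow ?A" using L by blast
        then show "1 * D ks (hc G M) x = (if ?K \<subseteq> M then hc G M x else 0)" using elim(3) by simp
      qed
      then show ?case using elim(1,2) reindex[OF L, of "\<lambda>M. hc G M x"] by simp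
    qed
  qed (use N in simp)
  ultimately show ?thesis
    using D_cond_exp[OF iH, of ?A ks]
  proof eventually_elim
    case (elim x)
    let ?g = "\<lambda>M. - (1 / real (card M)) * hc G M x"
    have "ce ?A (D ks H) x = (\<Sum>M\<in>?J. - (1 / real (card M)) * D ks (hc G M) x)"
      using elim(1,2,5) by simp
    \<comment> \<open>The empty set, omitted by the series, can be added back: its term is 0, as it
      does not contain the nonempty K (and 1 / 0 defaults to 0).\<close>
    also have "\<dots> = (\<Sum>M\<in>Pow ?A. if ?K \<subseteq> M then ?g M else 0)"
      using A elim(3) by (intro sum.mono_neutral_cong_left) auto
    also have "\<dots> = (\<Sum>J\<in>Pow N. ?g (?K \<union> J))"
      by (rule reindex) simp
    also have "\<dots> = - (\<Sum>J\<in>Pow N. (\<Sum>L\<in>{L. J \<subseteq> L \<and> L \<subseteq> N}. c L) * hc G (?K \<union> J) x)"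
      unfolding sum_negf[symmetric]
    proof (rule sum.cong[OF refl])
      fix J assume J: "J \<in> Pow N"
      \<comment> \<open>Distinct indices give K exactly \<open>length ks\<close> elements; this is
        the source of the constant d.\<close>
      then have "card (?K \<union> J) = length ks + card J"
        using finL[OF J] by (subst card_Un_disjoint) (auto simp: distinct_card[OF ks(1)])
      then show "?g (?K \<union> J) = - ((\<Sum>L\<in>{L. J \<subseteq> L \<and> L \<subseteq> N}. c L) * hc G (?K \<union> J) x)"
        using c[of J] J by simp
    qed
    also have "(\<Sum>J\<in>Pow N. (\<Sum>L\<in>{L. J \<subseteq> L \<and> L \<subseteq> N}. c L) * hc G (?K \<union> J) x)
       = (\<Sum>J\<in>Pow N. \<Sum>L\<in>{L\<in>Pow N. J \<subseteq> L}. c L * hc G (?K \<union> J) x)"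
      unfolding sum_distrib_right by (intro sum.cong refl) auto
    also have "\<dots> = (\<Sum>L\<in>Pow N. \<Sum>J\<in>{J\<in>Pow N. J \<subseteq> L}. c L * hc G (?K \<union> J) x)"
      using N by (intro sum.swap_restrict) auto
    also have "\<dots> = (\<Sum>L\<in>Pow N. c L * (\<Sum>J\<in>Pow L. hc G (?K \<union> J) x))"
      unfolding sum_distrib_left by (intro sum.cong refl) auto
    also have "\<dots> = (\<Sum>L\<in>Pow N. c L * ce (?K \<union> L) (D ks G) x)"
      using elim(4) by (intro sum.cong) auto
    finally show ?case .
  qed
qed

text \<open>The factor \<open>length ks\<close> normalizes the weights to total mass 1, which turns
  the preceding identity into a convex combination up to sign. Indices of N that lie in
  \<open>set ks\<close> are dropped, as this does not change the union.\<close>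

lemma cond_exp_D_OU_abs_powr:
  assumes r: "1 \<le> r" and G: "G \<in> borel_measurable P" "integrable P (\<lambda>x. \<bar>G x\<bar> powr r)"
    and H: "has_L2_sum P E X (\<lambda>M \<omega>. - (1 / real (card M)) * hc G M \<omega>) {M. finite M \<and> M \<noteq> {}} H"
    and ks: "distinct ks" "ks \<noteq> []" and N: "finite N"
  shows "integrable P (\<lambda>x. \<bar>length ks * ce (set ks \<union> N) (D ks H) x\<bar> powr r)"
    and "(\<integral>x. \<bar>length ks * ce (set ks \<union> N) (D ks H) x\<bar> powr r \<partial>P) \<le> (\<integral>x. \<bar>D ks G x\<bar> powr r \<partial>P)"
proof -
  let ?N = "N - set ks"
  have N': "finite ?N" "?N \<inter> set ks = {}" using N by auto
  have d: "1 \<le> length ks" using ks by (cases ks) auto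
  obtain c :: "nat set \<Rightarrow> real" where c: "\<And>L. 0 \<le> c L"
    "\<And>J. J \<subseteq> ?N \<Longrightarrow> (\<Sum>L\<in>{L. J \<subseteq> L \<and> L \<subseteq> ?N}. c L) = 1 / (length ks + card J)"
    using averaging_weights[OF N'(1) d] by blast
  have mH: "H \<in> borel_measurable P" using has_L2_sum_integrable(3)[OF H] by auto
  let ?f = "\<lambda>x. \<Sum>L\<in>Pow ?N. (length ks * c L) * ce (set ks \<union> L) (D ks G) x"
  have "AE x in P. ce (set ks \<union> ?N) (D ks H) x = - (\<Sum>L\<in>Pow ?N. c L * ce (set ks \<union> L) (D ks G) x)"
    by (rule cond_exp_D_OU[OF integrable_of_abs_powr[OF r G] H ks N' c(2)])
  then have eq: "AE x in P. \<bar>?f x\<bar> powr r = \<bar>length ks * ce (set ks \<union> N) (D ks H) x\<bar> powr r"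
    by eventually_elim (simp add: sum_distrib_left mult.assoc abs_mult)
  \<comment> \<open>The total mass is the weight identity for J = {}.\<close>
  have "(\<Sum>L\<in>Pow ?N. c L) = 1 / length ks"
    using c(2)[of "{}"] by (simp add: Pow_def)
  then have s: "(\<Sum>L\<in>Pow ?N. length ks * c L) = 1"
    using ks(2) by (simp flip: sum_distrib_left)
  note D_G = D_measurable[OF G(1)] integrable_abs_powr_D[OF r G]
  have f: "integrable P (\<lambda>x. \<bar>?f x\<bar> powr r)" "(\<integral>x. \<bar>?f x\<bar> powr r \<partial>P) \<le> (\<integral>x. \<bar>D ks G x\<bar> powr r \<partial>P)"
    using weighted_cond_exp_abs_powr[OF r D_G, of "Pow ?N" "\<lambda>L. length ks * c L" "\<lambda>L. set ks \<union> L"] N' c(1) s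
    by auto
  show "integrable P (\<lambda>x. \<bar>length ks * ce (set ks \<union> N) (D ks H) x\<bar> powr r)"
    by (rule integrable_cong_AE_imp[OF f(1) _ eq]) measurable
  have "(\<integral>x. \<bar>length ks * ce (set ks \<union> N) (D ks H) x\<bar> powr r \<partial>P) = (\<integral>x. \<bar>?f x\<bar> powr r \<partial>P)"
    by (rule integral_cong_AE) (use eq in auto)
  with f(2) show "(\<integral>x. \<bar>length ks * ce (set ks \<union> N) (D ks H) x\<bar> powr r \<partial>P) \<le> (\<integral>x. \<bar>D ks G x\<bar> powr r \<partial>P)"
    by simp
qed

text \<open>The bound is uniform along the segments \<open>{..<n}\<close>, which eventually contain
  every finite M. The \<open>L\<^sup>1\<close> convergence known for H moves to
  \<open>D ks H\<close> by commutation with conditional expectations and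
  \<open>D_L1\<close>.\<close>

lemma D_OU_abs_powr:
  assumes r: "1 \<le> r" and G: "G \<in> borel_measurable P" "integrable P (\<lambda>x. \<bar>G x\<bar> powr r)"
    and H: "has_L2_sum P E X (\<lambda>M \<omega>. - (1 / real (card M)) * hc G M \<omega>) {M. finite M \<and> M \<noteq> {}} H"
    and ks: "distinct ks" "ks \<noteq> []"
  shows "integrable P (\<lambda>x. \<bar>length ks * D ks H x\<bar> powr r)"
    and "(\<integral>x. \<bar>length ks * D ks H x\<bar> powr r \<partial>P) \<le> (\<integral>x. \<bar>D ks G x\<bar> powr r \<partial>P)"
proof -
  let ?A = "\<lambda>n. set ks \<union> {..<n::nat}"
  let ?I = "{M::nat set. finite M \<and> M \<noteq> {}}"
  have iG: "integrable P G" by (rule integrable_of_abs_powr[OF r G])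
  have iH: "integrable P H" using has_L2_sum_integrable(3)[OF H] .
  have [measurable]: "H \<in> borel_measurable P" using iH by auto
  have iDH: "integrable P (D ks H)" by (rule integrable_D[OF iH])
  have ic: "integrable P (ce (?A n) H)" for n by (rule ce.real_cond_exp_int(1)[OF iH])
  have lim: "(\<lambda>n. \<integral>x. \<bar>ce (?A n) H x - H x\<bar> \<partial>P) \<longlonglongrightarrow> 0"
  proof (rule cond_exp_L2_sum_tendsto[OF H])
    fix M :: "nat set" assume M: "M \<in> ?I"
    then obtain m where m: "M \<subseteq> {..<m}"
      using finite_nat_iff_bounded by auto
    show "\<forall>\<^sub>F n in sequentially. AE x in P. ce (?A n) (\<lambda>\<omega>. - (1 / real (card M)) * hc G M \<omega>) x
        = - (1 / real (card M)) * hc G M x"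
      using eventually_ge_at_top[of m]
    proof eventually_elim
      case (elim n)
      have sub: "M \<subseteq> ?A n" using m elim by auto
      have "AE x in P. ce (?A n) (\<lambda>\<omega>. - (1 / real (card M)) * hc G M \<omega>) x
          = - (1 / real (card M)) * ce (?A n) (hc G M) x"
        by (rule ce.real_cond_exp_cmult[OF integrable_hc[OF iG]])
      moreover have "AE x in P. ce (?A n) (hc G M) x = hc G M x"
        using cond_exp_hc[OF iG, of M "?A n"] M sub by simp
      ultimately show ?case by eventually_elim simp
    qed
  qed
  have le: "(\<integral>x. \<bar>ce (?A n) (D ks H) x - D ks H x\<bar> \<partial>P) \<le> 2 ^ length ks * (\<integral>x. \<bar>ce (?A n) H x - H x\<bar> \<partial>P)" for n
  proof -
    have "AE x in P. D ks (\<lambda>x. ce (?A n) H x - H x) x = D ks (ce (?A n) H) x - D ks H x"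
      by (rule D_diff[OF ic iH])
    then have "AE x in P. \<bar>ce (?A n) (D ks H) x - D ks H x\<bar> = \<bar>D ks (\<lambda>x. ce (?A n) H x - H x) x\<bar>"
      using D_cond_exp[OF iH, of "?A n" ks] by eventually_elim simp
    then have "(\<integral>x. \<bar>ce (?A n) (D ks H) x - D ks H x\<bar> \<partial>P) = (\<integral>x. \<bar>D ks (\<lambda>x. ce (?A n) H x - H x) x\<bar> \<partial>P)"
      by (intro integral_cong_AE) auto
    also have "\<dots> \<le> 2 ^ length ks * (\<integral>x. \<bar>ce (?A n) H x - H x\<bar> \<partial>P)"
      using ic iH by (intro D_L1) auto
    finally show ?thesis .
  qed
  have "(\<lambda>n. \<integral>x. norm (ce (?A n) (D ks H) x - D ks H x) \<partial>P) \<longlonglongrightarrow> 0"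
  proof (rule tendsto_sandwich[OF _ _ tendsto_const])
    show "(\<lambda>n. 2 ^ length ks * (\<integral>x. \<bar>ce (?A n) H x - H x\<bar> \<partial>P)) \<longlonglongrightarrow> 0"
      using tendsto_mult_right_zero[OF lim] .
  qed (use le in auto)
  then obtain \<rho> where "AE x in P. (\<lambda>n. ce (?A (\<rho> n)) (D ks H) x - D ks H x) \<longlonglongrightarrow> 0"
    using tendsto_L1_AE_subseq[of P "\<lambda>n x. ce (?A n) (D ks H) x - D ks H x"] iDH
    by (auto intro: ce.real_cond_exp_int)
  then have *: "AE x in P. (\<lambda>n. \<bar>length ks * ce (?A (\<rho> n)) (D ks H) x\<bar> powr r) \<longlonglongrightarrow> \<bar>length ks * D ks H x\<bar> powr r"
  proof eventually_elim
    case (elim x)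
    then have "(\<lambda>n. ce (?A (\<rho> n)) (D ks H) x) \<longlonglongrightarrow> D ks H x" by (simp add: LIM_zero_iff)
    \<comment> \<open>Continuity of the power at base 0 rests on the exponent r being
      positive.\<close>
    then show ?case using r by (intro tendsto_intros tendsto_powr') auto
  qed
  show "integrable P (\<lambda>x. \<bar>length ks * D ks H x\<bar> powr r)"
    "(\<integral>x. \<bar>length ks * D ks H x\<bar> powr r \<partial>P) \<le> (\<integral>x. \<bar>D ks G x\<bar> powr r \<partial>P)"
    by (rule integral_le_of_AE_limit[OF _ _ _ *, where C = "\<integral>x. \<bar>D ks G x\<bar> powr r \<partial>P"];
        use cond_exp_D_OU_abs_powr[OF r G H ks finite_lessThan] in auto)+
qed

end

section \<open>Removal of the centering and passage to r-th roots\<close>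

theorem proposition2p15:
  fixes P :: "'a measure" and E :: "nat \<Rightarrow> 'b measure" and X :: "nat \<Rightarrow> 'a \<Rightarrow> 'b"
    and F :: "'a \<Rightarrow> real" and r :: real and d :: nat and ks :: "nat list"
  assumes "prob_space P"
    and "\<And>n. prob_space (E n)"
    and "\<And>n. X n \<in> measurable P (E n)"
    and "\<And>n. distr P (E n) (X n) = E n"
    and "prob_space.indep_vars P E X UNIV"
    and "1 \<le> r"
    and "F \<in> Lr_space P E X 2 \<inter> Lr_space P E X r"
    and "1 \<le> d"
    and "length ks = d" and "distinct ks"
  shows "iterated_D P E X ks (OU_pseudo_inverse P E X (\<lambda>\<omega>. F \<omega> - (\<integral>\<omega>'. F \<omega>' \<partial>P)))
           \<in> Lr_space P E X r \<and>
         Lr_norm P r (iterated_D P E X ks (OU_pseudo_inverse P E X (\<lambda>\<omega>. F \<omega> - (\<integral>\<omega>'. F \<omega>' \<partial>P))))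
           \<le> (1 / real d) * Lr_norm P r (iterated_D P E X ks F)"
proof -
  interpret prob_space P by fact
  interpret indep_family P E X by unfold_locales fact
  define m where "m = (\<integral>\<omega>. F \<omega> \<partial>P)"
  let ?G = "\<lambda>\<omega>. F \<omega> - m"
  define H where "H = OU_pseudo_inverse P E X ?G"
  have F: "F \<in> borel_measurable (\<S> UNIV)" "integrable P (\<lambda>x. (F x)\<^sup>2)" "integrable P (\<lambda>x. \<bar>F x\<bar> powr r)"
    using assms(7) Lr_space_2_iff by (auto simp: Lr_space_def)
  have Fm: "F \<in> borel_measurable P" using F(1) by (rule measurable_sigma_of)
  have iF: "integrable P F" using Fm F(2) by (rule square_integrable_imp_integrable)
  have ks: "ks \<noteq> []" using assms(8,9) by auto
  have "integrable P (\<lambda>x. (?G x)\<^sup>2)"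
    using square_integrable_add[of F "\<lambda>_. - m"] Fm F(2) by simp
  then have "?G \<in> Lr_space P E X 2"
    using F(1) by (simp add: Lr_space_2_iff)
  from has_L2_sum_OU_pseudo_inverse[OF this]
  have H: "has_L2_sum P E X (\<lambda>M \<omega>. - (1 / real (card M)) * hc ?G M \<omega>) {M. finite M \<and> M \<noteq> {}} H"
    unfolding H_def .
  have G: "?G \<in> borel_measurable P" using Fm by simp
  have Gr: "integrable P (\<lambda>x. \<bar>?G x\<bar> powr r)"
    using Fm F(3) assms(6) by (intro integrable_abs_powr_diff) auto
  note D_H = D_OU_abs_powr[OF assms(6) G Gr H assms(10) ks, unfolded assms(9)]
  have eq: "\<bar>d * D ks H x\<bar> powr r = real d powr r * \<bar>D ks H x\<bar> powr r" for x
    by (simp add: abs_mult powr_mult)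
  have d: "0 < real d" "0 < real d powr r" using assms(8) by auto
  have int: "integrable P (\<lambda>x. \<bar>D ks H x\<bar> powr r)"
    using D_H(1) d unfolding eq by simp
  have DFG: "(\<integral>x. \<bar>D ks ?G x\<bar> powr r \<partial>P) = (\<integral>x. \<bar>D ks F x\<bar> powr r \<partial>P)"
    using D_diff_const[OF iF ks, of m] Fm by (intro integral_cong_AE) (auto elim!: AE_mp)
  have "real d powr r * (\<integral>x. \<bar>D ks H x\<bar> powr r \<partial>P) \<le> (\<integral>x. \<bar>D ks F x\<bar> powr r \<partial>P)"
    using D_H(2) unfolding eq DFG by simp
  then have "(real d powr r * (\<integral>x. \<bar>D ks H x\<bar> powr r \<partial>P)) powr (1 / r)
      \<le> (\<integral>x. \<bar>D ks F x\<bar> powr r \<partial>P) powr (1 / r)"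
    using assms(6) by (intro powr_mono2) auto
  then have "real d * Lr_norm P r (D ks H) \<le> Lr_norm P r (D ks F)"
    using assms(6) d by (simp add: Lr_norm_def powr_mult powr_powr)
  then have "Lr_norm P r (D ks H) \<le> (1 / real d) * Lr_norm P r (D ks F)"
    using d by (simp add: field_simps)
  moreover have "D ks H \<in> Lr_space P E X r"
    using D_measurable_sigma_of[OF has_L2_sum_integrable(1)[OF H]] int by (simp add: Lr_space_def)
  ultimately show ?thesis unfolding H_def m_def by simp
qed

end
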